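(* Let $q\equiv 3\pmod 4$ be a prime power with $q\neq 3$, and let $C_0=\{\mathbf{r}\in\mathbb{F}_q^4:(\mathbf{r},\mathbf{r})=0\}$. A map $\varphi:\mathbb{F}_q^4\setminus C_0\to\mathbb{F}_q^4\setminus C_0$ satisfies, for all $\mathbf{r}_1,\mathbf{r}_2\in\mathbb{F}_q^4\setminus C_0$, $$(\mathbf{r}_1-\mathbf{r}_2,\mathbf{r}_1-\mathbf{r}_2)=0,\ \mathbf{r}_1\neq\mathbf{r}_2\ \Longrightarrow\ \big(\varphi(\mathbf{r}_1)-\varphi(\mathbf{r}_2),\varphi(\mathbf{r}_1)-\varphi(\mathbf{r}_2)\big)=0,\ \varphi(\mathbf{r}_1)\neq\varphi(\mathbf{r}_2),$$ if and only if it has one of the following four forms (for all $\mathbf{r}$): $$\varphi(\mathbf{r})=\alpha L\mathbf{r}^\tau,\quad \varphi(\mathbf{r})=\alpha K\mathbf{r}^\tau,\quad \varphi(\mathbf{r})=\frac{\alpha L\mathbf{r}^\tau}{(\mathbf{r}^\tau,\mathbf{r}^\tau)},\quad \varphi(\mathbf{r})=\frac{\alpha K\mathbf{r}^\tau}{(\mathbf{r}^\tau,\mathbf{r}^\tau)},$$ where $0\neq\alpha\in\mathbb{F}_q$ is fixed, $\tau$ is an automorphism of $\mathbb{F}_q$ applied coordinate-wise, and $L$ and $K$ are a Lorentz and an anti-Lorentz matrix respectively.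
   Context: For $\mathbf{r}_k=(x_k,y_k,z_k,t_k)^\top\in\mathbb{F}_q^4$ put $(\mathbf{r}_1,\mathbf{r}_2)=-x_1x_2-y_1y_2-z_1z_2+t_1t_2$. A $4\times4$ matrix $L$ over $\mathbb{F}_q$ is Lorentz if $(L\mathbf{r}_1,L\mathbf{r}_2)=(\mathbf{r}_1,\mathbf{r}_2)$ for all $\mathbf{r}_1,\mathbf{r}_2\in\mathbb{F}_q^4$, and anti-Lorentz if $(K\mathbf{r}_1,K\mathbf{r}_2)=-(\mathbf{r}_1,\mathbf{r}_2)$ for all $\mathbf{r}_1,\mathbf{r}_2$. *)

theory Defs
  imports "HOL-Analysis.Analysis"
begin

text \<open>Vectors r = (x,y,z,t) in F_q^4 are elements of 'a^4 with coordinates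
  r$1 = x, r$2 = y, r$3 = z, r$4 = t.\<close>

definition mink :: "'a::comm_ring_1 ^ 4 \<Rightarrow> 'a ^ 4 \<Rightarrow> 'a" where
  "mink r1 r2 = - (r1$1 * r2$1) - r1$2 * r2$2 - r1$3 * r2$3 + r1$4 * r2$4"

definition lorentz :: "'a::comm_ring_1 ^ 4 ^ 4 \<Rightarrow> bool" where
  "lorentz L \<longleftrightarrow> (\<forall>r1 r2. mink (L *v r1) (L *v r2) = mink r1 r2)"

definition anti_lorentz :: "'a::comm_ring_1 ^ 4 ^ 4 \<Rightarrow> bool" where
  "anti_lorentz K \<longleftrightarrow> (\<forall>r1 r2. mink (K *v r1) (K *v r2) = - mink r1 r2)"

definition light_cone :: "('a::comm_ring_1 ^ 4) set" where
  "light_cone = {r. mink r r = 0}"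

definition field_automorphism :: "('a::field \<Rightarrow> 'a) \<Rightarrow> bool" where
  "field_automorphism \<tau> \<longleftrightarrow> bij \<tau> \<and> (\<forall>x y. \<tau> (x + y) = \<tau> x + \<tau> y)
      \<and> (\<forall>x y. \<tau> (x * y) = \<tau> x * \<tau> y) \<and> \<tau> 1 = 1"

definition vmap :: "('a \<Rightarrow> 'a) \<Rightarrow> 'a ^ 4 \<Rightarrow> 'a ^ 4" where
  "vmap \<tau> r = (\<chi> i. \<tau> (r $ i))"

end

(*
  Two points are adjacent if they differ by a nonzero null vector. Since q = 3 mod 4, the form has
  Witt index 1, so pairwise adjacent points lie on a null line, and a null line contained in a
  sphere (r, r) = c is mapped onto such a line again. A sphere with these lines is a generalized
  quadrangle Q(4,q) without an elliptic ovoid. If the map identifies two lines through a point of a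
  sphere, then it sends that sphere, and then the whole space, to a single line; a double count
  excludes this colouring with q colours. Hence the map is injective on every sphere, permutes the
  spheres, and is an automorphism of the adjacency graph.

  The automorphism induces a permutation of the null directions. They form a Moebius plane whose
  circles are the polars of the points off the cone and are preserved. Removing one direction leaves
  an affine plane over F_q, whose collineations are semilinear, and the remaining circles force the
  collineation to be a similitude. So the map is r -> m((r,r)) L r^tau with a similitude L,
  and adjacency between spheres leaves only the possibilities that m(c) or m(c) c^tau is constant.
*)
theory Submission
  imports Defs
begin

section \<open>The field and its null directions\<close>

text \<open>Adjacency is preserved in one direction only and \<open>\<phi>\<close> is not known to
  be injective, so surjectivity has to come from finiteness: q points with pairwise different images
  on a line of q points fill it. This needs complete lines. Along a null line the value (r, r) is an
  affine function of the parameter, so the line either stays on one level set or meets the cone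
  exactly once and loses a point there. Only null lines inside a sphere are mapped onto null lines,
  which is why spheres carry the argument. The congruence q = 3 mod 4 enters in two forms: -1 is not
  a square, so a^2 + b^2 is anisotropic and different null directions are never orthogonal; and
  every scalar is plus or minus a square, so a similitude is a multiple of a Lorentz or of an
  anti-Lorentz matrix. Excluding q = 3 gives q >= 7, so that a scalar can be chosen outside three
  prescribed values when two lines are identified.\<close>

locale minkowski_field =
  fixes ty :: "'a::{field,finite} itself"
  assumes card_mod: "CARD('a) mod 4 = 3"
    and card_ne_3: "CARD('a) \<noteq> 3"
begin

lemma card_ge: "CARD('a) \<ge> 7"
  using card_mod card_ne_3 by presburger

section \<open>Arithmetic of a finite field with q = 3 mod 4\<close>

lemma fermat:
  fixes x :: 'a
  assumes "x \<noteq> 0"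
  shows "x ^ (CARD('a) - 1) = 1"
proof -
  let ?U = "UNIV - {0::'a}"
  have "bij_betw ((*) x) ?U ?U"
    by (rule bij_betw_byWitness[where f' = "\<lambda>y. y / x"]) (use assms in auto)
  then have "(\<Prod>y\<in>?U. y) = (\<Prod>y\<in>?U. x * y)"
    by (rule prod.reindex_bij_betw[symmetric])
  also have "\<dots> = x ^ card ?U * (\<Prod>y\<in>?U. y)"
    by (simp add: prod.distrib)
  finally show ?thesis
    by (auto simp: card_Diff_singleton)
qed

text \<open>Translation by 1 permutes the field, so summing all elements before and after gives q =
  0 in the field; as q is odd, 2 = 0 would give 1 = 0.\<close>

lemma two_ne_0: "(2::'a) \<noteq> 0"
proof
  assume "(2::'a) = 0"
  have "(\<Sum>x\<in>(UNIV::'a set). x + 1) = (\<Sum>x\<in>UNIV. x)"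
    by (rule sum.reindex_bij_betw) (rule bij_betw_byWitness[where f' = "\<lambda>y. y - 1"], auto)
  then have "of_nat (CARD('a)) = (0::'a)"
    by (simp add: sum.distrib)
  moreover have "CARD('a) = 2 * (2 * (CARD('a) div 4) + 1) + 1"
    using card_mod by presburger
  ultimately have "2 * of_nat (2 * (CARD('a) div 4) + 1) + 1 = (0::'a)"
    by (metis of_nat_1 of_nat_add of_nat_mult of_nat_numeral)
  with \<open>(2::'a) = 0\<close> show False by simp
qed

lemma four_ne_0: "(4::'a) \<noteq> 0"
  using two_ne_0 by (metis mult_eq_0_iff numeral_Bit0_eq_double)

lemma minus_self_iff: "- x = x \<longleftrightarrow> x = (0::'a)"
  using two_ne_0 by (metis add.inverse_neutral eq_neg_iff_add_eq_0 mult_2 mult_eq_0_iff)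

text \<open>The exponent (q - 1)/2 is odd, so a square root of -1 would have (q - 1)-th power
  -1.\<close>

lemma minus_1_not_square: "(i::'a) * i \<noteq> - 1"
proof
  assume i: "i * i = - 1"
  then have "i \<noteq> 0" by auto
  have q: "CARD('a) - 1 = 2 * (2 * (CARD('a) div 4) + 1)"
    using card_mod by presburger
  have "i ^ (CARD('a) - 1) = (i * i) ^ (2 * (CARD('a) div 4) + 1)"
    unfolding q power_mult by (simp add: power2_eq_square)
  then have "i ^ (CARD('a) - 1) = - 1"
    using i by simp
  then show False
    using fermat[OF \<open>i \<noteq> 0\<close>] minus_self_iff[of 1] by simp
qed

lemma sum_squares_eq_0:
  assumes "a * a + b * b = (0::'a)"
  shows "a = 0 \<and> b = 0"
proof (cases "b = 0")
  case False
  then have "(a / b) * (a / b) = - 1"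
    using assms by (simp add: eq_neg_iff_add_eq_0 divide_simps)
  then show ?thesis using minus_1_not_square by blast
qed (use assms in auto)

lemma plus_minus_square: "\<exists>m. x = m * m \<or> x = - (m * m :: 'a)"
proof (cases "x = 0")
  case False
  define n where "n = CARD('a) div 4"
  have q: "CARD('a) - 1 = 2 * (2 * n + 1)"
    using card_mod unfolding n_def by presburger
  have "(x ^ (2 * n + 1)) ^ 2 = 1"
    using fermat[OF False] unfolding q by (metis power_mult mult.commute)
  then have "x ^ (2 * n + 1) = 1 \<or> x ^ (2 * n + 1) = - 1"
    by (simp add: power2_eq_1_iff)
  \<comment> \<open>For q = 4n + 3 the exponent n + 1 is (q + 1)/4, so the square of this power is x
    times the quadratic character of x.\<close>
  moreover have "x ^ (n + 1) * x ^ (n + 1) = x * x ^ (2 * n + 1)"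
    by (metis add.assoc add.commute mult_2 power_Suc power_add Suc_eq_plus1)
  ultimately have "x ^ (n + 1) * x ^ (n + 1) = x \<or> x ^ (n + 1) * x ^ (n + 1) = - x"
    by (metis mult.right_neutral mult_minus_right)
  then show ?thesis by (metis minus_minus)
qed auto

text \<open>Pigeonhole: the squares and their negatives cover the field and q is odd, so more than
  half of the elements are squares, and the set of squares meets its reflection under x -> -1 -
  x.\<close>

lemma minus_1_sum_squares: "\<exists>a b::'a. a * a + b * b = - 1"
proof -
  define S where "S = range (\<lambda>m::'a. m * m)"
  have "x \<in> S \<union> uminus ` S" for x
    using plus_minus_square[of x] unfolding S_def by auto
  then have 1: "S \<union> uminus ` S = UNIV" by blast
  have "CARD('a) \<le> card S + card (uminus ` S)"
    using card_Un_le[of S "uminus ` S"] 1 by simp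
  then have "CARD('a) \<le> 2 * card S"
    using card_image_le[of S uminus] by simp
  then have "CARD('a) < 2 * card S"
    using card_mod by presburger
  define T where "T = (\<lambda>x. - 1 - x) ` S"
  have "card T = card S"
    unfolding T_def by (intro card_image inj_onI) auto
  have "S \<inter> T \<noteq> {}"
  proof
    assume "S \<inter> T = {}"
    then have "card (S \<union> T) = card S + card T" by (simp add: card_Un_disjoint)
    moreover have "card (S \<union> T) \<le> CARD('a)" by (simp add: card_mono)
    ultimately show False using \<open>card T = card S\<close> \<open>CARD('a) < 2 * card S\<close> by simp
  qed
  then obtain a b :: 'a where "a * a = - 1 - b * b"
    unfolding S_def T_def by auto
  then have "a * a + b * b = - 1" by simp
  then show ?thesis by blast
qed

definition circle :: "'a \<Rightarrow> ('a \<times> 'a) set" where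
  "circle r = {(a, b). a * a + b * b = r}"

text \<open>Multiplication by a Gaussian number of norm \<open>r\<close> maps the unit circle onto
  the circle of radius \<open>r\<close>, so all these circles are equinumerous.\<close>

lemma card_circle:
  assumes "r \<noteq> 0"
  shows "card (circle r) = CARD('a) + 1"
proof -
  have ex: "\<exists>u v. u * u + v * v = r" for r :: 'a
  proof -
    obtain m where m: "r = m * m \<or> r = - (m * m)" using plus_minus_square by blast
    obtain a b :: 'a where ab: "a * a + b * b = - 1" using minus_1_sum_squares by blast
    have "(m * a) * (m * a) + (m * b) * (m * b) = (m * m) * (a * a + b * b)"
      by (simp add: algebra_simps)
    then have "(m * a) * (m * a) + (m * b) * (m * b) = - (m * m)"
      unfolding ab by simp
    with m show ?thesis by (metis add.right_neutral mult_zero_left)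
  qed
  have le: "card (circle t) \<le> card (circle s)" if "s \<noteq> 0" "t \<noteq> 0" for s t
  proof -
    obtain u v where uv: "u * u + v * v = s / t" using ex by blast
    define h where "h = (\<lambda>(a, b). (u * a - v * b, u * b + v * a))"
    have "h (a, b) = h (c, d) \<Longrightarrow> (a, b) = (c, d)" for a b c d
    proof -
      assume "h (a, b) = h (c, d)"
      then have e: "u * (a - c) - v * (b - d) = 0" "u * (b - d) + v * (a - c) = 0"
        unfolding h_def by (auto simp: algebra_simps)
      have "(u * u + v * v) * (a - c) = u * (u * (a - c) - v * (b - d)) + v * (u * (b - d) + v * (a - c))"
        "(u * u + v * v) * (b - d) = u * (u * (b - d) + v * (a - c)) - v * (u * (a - c) - v * (b - d))"
        by (simp_all add: algebra_simps)
      then show ?thesis unfolding e uv using that by auto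
    qed
    then have "inj_on h (circle t)" by (auto intro!: inj_onI)
    moreover have "h ` circle t \<subseteq> circle s"
    proof -
      have "(u * a - v * b) * (u * a - v * b) + (u * b + v * a) * (u * b + v * a) = s"
        if "a * a + b * b = t" for a b
      proof -
        have "(u * a - v * b) * (u * a - v * b) + (u * b + v * a) * (u * b + v * a)
            = (u * u + v * v) * (a * a + b * b)" by (simp add: algebra_simps)
        then show ?thesis unfolding uv that using \<open>t \<noteq> 0\<close> by simp
      qed
      then show ?thesis unfolding h_def circle_def by auto
    qed
    ultimately show ?thesis by (meson card_inj_on_le finite)
  qed
  have zero: "circle 0 = {(0, 0)}"
  proof -
    have "a * a + b * b = 0 \<longleftrightarrow> a = 0 \<and> b = 0" for a b :: 'a
      using sum_squares_eq_0[of a b] by auto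
    then show ?thesis unfolding circle_def by auto
  qed
  \<comment> \<open>The plane is partitioned by the radii. Radius 0 takes one point, and the q - 1
    other circles share the remaining q^2 - 1 points equally.\<close>
  have "x \<in> (\<Union>t. circle t)" for x
    unfolding circle_def by (cases x) simp
  then have "(\<Union>t. circle t) = UNIV \<times> UNIV"
    by (simp add: set_eq_iff)
  then have "CARD('a) * CARD('a) = card (\<Union>t. circle t)"
    by (simp only: card_cartesian_product)
  also have "\<dots> = (\<Sum>t\<in>UNIV. card (circle t))"
    by (rule card_UN_disjoint) (auto simp: circle_def)
  also have "\<dots> = card (circle 0) + (\<Sum>t\<in>UNIV - {0}. card (circle t))"
    by (simp add: sum.remove)
  also have "(\<Sum>t\<in>UNIV - {0}. card (circle t)) = (\<Sum>t\<in>UNIV - {0::'a}. card (circle r))"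
    by (rule sum.cong) (use le assms in \<open>auto intro: le_antisym\<close>)
  also have "\<dots> = (CARD('a) - 1) * card (circle r)" by simp
  finally have eq: "CARD('a) * CARD('a) = 1 + (CARD('a) - 1) * card (circle r)"
    by (simp add: zero)
  obtain n where n: "CARD('a) = Suc n" "n > 0"
    using card_ge by (cases "CARD('a)") auto
  then have "n * (n + 2) = n * card (circle r)" using eq by simp
  then have "n + 2 = card (circle r)" using n(2) by (simp only: mult_cancel1) simp
  then show ?thesis using n by simp
qed

end

section \<open>The bilinear form\<close>

lemma mink_commute: "mink x y = mink y x"
  unfolding mink_def by (simp add: algebra_simps)

lemma mink_linear:
  "mink (x + y) z = mink x z + mink y z" "mink z (x + y) = mink z x + mink z y"
  "mink (x - y) z = mink x z - mink y z" "mink z (x - y) = mink z x - mink z y"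
  "mink (k *s x) z = k * mink x z" "mink z (k *s x) = k * mink z x"
  "mink (- x) z = - mink x z" "mink z (- x) = - mink z x"
  "mink 0 z = 0" "mink z 0 = 0"
  unfolding mink_def by (simp_all add: algebra_simps)

lemma mink_nondegenerate:
  fixes v :: "'a::comm_ring_1 ^ 4"
  assumes "\<And>w. mink v w = 0"
  shows "v = 0"
proof -
  have "mink v (axis 1 1) = 0" "mink v (axis 2 1) = 0" "mink v (axis 3 1) = 0" "mink v (axis 4 1) = 0"
    using assms by auto
  then show ?thesis
    unfolding mink_def by (simp add: axis_def vec_eq_iff forall_4)
qed

text \<open>Independence makes the coordinate map injective, and an injective self-map of a finite
  set is onto.\<close>

lemma inj_combination_spans:
  fixes v1 v2 v3 v4 :: "'a::{field,finite} ^ 4"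
  assumes "\<And>a b c d. a *s v1 + b *s v2 + c *s v3 + d *s v4 = 0 \<Longrightarrow> a = 0 \<and> b = 0 \<and> c = 0 \<and> d = 0"
  obtains a b c d where "x = a *s v1 + b *s v2 + c *s v3 + d *s v4"
proof -
  define g :: "'a ^ 4 \<Rightarrow> 'a ^ 4"
    where "g k = k$1 *s v1 + k$2 *s v2 + k$3 *s v3 + k$4 *s v4" for k
  have "inj g"
  proof (rule injI)
    fix k l assume "g k = g l"
    then have "(k$1 - l$1) *s v1 + (k$2 - l$2) *s v2 + (k$3 - l$3) *s v3 + (k$4 - l$4) *s v4 = 0"
      unfolding g_def vec_eq_iff by (simp add: algebra_simps)
    from assms[OF this] show "k = l" by (simp add: vec_eq_iff forall_4)
  qed
  then have "surj g" by (simp add: finite_UNIV_inj_surj)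
  then obtain k where "x = g k" by blast
  then show ?thesis using that unfolding g_def by blast
qed

section \<open>Null directions as points of a Moebius plane\<close>

definition vec4 :: "'a \<Rightarrow> 'a \<Rightarrow> 'a \<Rightarrow> 'a \<Rightarrow> 'a ^ 4" where
  "vec4 a b c d = (\<chi> i. if i = 1 then a else if i = 2 then b else if i = 3 then c else d)"

lemma vec4_nth [simp]:
  "vec4 a b c d $ 1 = a" "vec4 a b c d $ 2 = b" "vec4 a b c d $ 3 = c" "vec4 a b c d $ 4 = d"
  unfolding vec4_def by simp_all

text \<open>Inverse stereographic projection: the null directions form a sphere, parametrised by the
  affine plane together with a point \<open>None\<close> at infinity. Each direction gets one fixed
  representative vector.\<close>

definition ray :: "('a::comm_ring_1 \<times> 'a) option \<Rightarrow> 'a ^ 4" where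
  "ray u = (case u of None \<Rightarrow> vec4 0 0 1 1
     | Some (a, b) \<Rightarrow> vec4 (2 * a) (2 * b) (a * a + b * b - 1) (a * a + b * b + 1))"

text \<open>For nonnull \<open>x\<close> this is a circle of the Moebius plane, and also the set of
  directions of the null lines through \<open>x\<close> that stay on the sphere of
  \<open>x\<close>.\<close>

definition perp :: "'a::comm_ring_1 ^ 4 \<Rightarrow> ('a \<times> 'a) option set" where
  "perp x = {u. mink x (ray u) = 0}"

lemma ray_null [simp]: "mink (ray u) (ray u) = 0"
  unfolding ray_def mink_def by (auto split: option.split simp: algebra_simps)

lemma mink_ray:
  "mink x (ray None) = x$4 - x$3"
  "mink x (ray (Some (a, b))) = (a * a + b * b) * (x$4 - x$3) - 2 * (a * x$1 + b * x$2) + (x$3 + x$4)"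
  unfolding ray_def mink_def by (auto simp: algebra_simps)

lemma ray_nth:
  "ray None $ 1 = 0" "ray None $ 2 = 0" "ray None $ 3 = 1" "ray None $ 4 = 1"
  "ray (Some (a, b)) $ 1 = 2 * a" "ray (Some (a, b)) $ 2 = 2 * b"
  "ray (Some (a, b)) $ 3 = a * a + b * b - 1" "ray (Some (a, b)) $ 4 = a * a + b * b + 1"
  unfolding ray_def by auto

context minkowski_field
begin

text \<open>For two finite parameters the product is twice the squared Euclidean distance, which is
  anisotropic here. This is Witt index 1 in the form used throughout.\<close>

lemma mink_ray_ray: "mink (ray u1) (ray u2 :: 'a ^ 4) = 0 \<longleftrightarrow> u1 = u2"
proof -
  have "mink (ray (Some (a, b))) (ray (Some (c, d))) = 0 \<longleftrightarrow> a = c \<and> b = d" for a b c d :: 'a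
  proof -
    have "mink (ray (Some (a, b))) (ray (Some (c, d))) = 2 * ((a - c) * (a - c) + (b - d) * (b - d))"
      unfolding mink_ray ray_nth by (simp add: algebra_simps)
    then show ?thesis
      using two_ne_0 sum_squares_eq_0[of "a - c" "b - d"] by (simp only: mult_eq_0_iff) auto
  qed
  moreover have "mink (ray None) (ray (Some p)) \<noteq> 0" "mink (ray (Some p)) (ray None) \<noteq> 0" for p :: "'a \<times> 'a"
    using two_ne_0 by (cases p; simp add: mink_ray ray_nth mult_2 flip: mult_2)+
  ultimately show ?thesis
    by (cases u1; cases u2) (auto simp del: ray_null simp: ray_null)
qed

lemma ray_ne_0: "ray u \<noteq> (0 :: 'a ^ 4)"
proof
  assume "ray u = (0 :: 'a ^ 4)"
  then have "mink (ray u) (ray u') = (0 :: 'a)" for u' by (simp add: mink_linear)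
  then show False using mink_ray_ray by (metis option.distinct(1))
qed

lemma scaled_ray_0 [simp]: "k *s ray u = (0 :: 'a ^ 4) \<longleftrightarrow> k = 0"
  using ray_ne_0 by (simp add: vector_mul_eq_0)

lemma scaled_ray_eq:
  assumes "k *s ray u1 = l *s (ray u2 :: 'a ^ 4)" "k \<noteq> 0 \<or> l \<noteq> 0"
  shows "u1 = u2 \<and> k = l"
proof -
  have "k \<noteq> 0" "l \<noteq> 0" using assms scaled_ray_0 by (metis vec.scale_zero_left)+
  have "k * mink (ray u1) (ray u2 :: 'a ^ 4) = l * mink (ray u2) (ray u2)"
    using arg_cong[OF assms(1), of "\<lambda>v. mink v (ray u2)"] by (simp only: mink_linear)
  then have "u1 = u2" using \<open>k \<noteq> 0\<close> by (simp add: mink_ray_ray)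
  then have "(k - l) *s ray u1 = (0 :: 'a ^ 4)" using assms(1) by (simp add: vector_sub_rdistrib)
  then show ?thesis using \<open>u1 = u2\<close> ray_ne_0 by simp
qed

text \<open>Stereographic projection: the scale is half of \<open>v$4 - v$3\<close>, the value that
  every finite \<open>ray\<close> has equal to 2. If it vanishes, anisotropy kills the first two
  coordinates and the point at infinity remains.\<close>

lemma null_is_scaled_ray:
  fixes v :: "'a ^ 4"
  assumes "mink v v = 0"
  obtains k u where "v = k *s ray u"
proof (cases "v$4 = v$3")
  case True
  then have "v$1 * v$1 + v$2 * v$2 = 0"
    using assms unfolding mink_def by (simp add: algebra_simps) (metis add.right_inverse)
  from sum_squares_eq_0[OF this] have "v = v$3 *s ray None"
    using True by (simp add: vec_eq_iff forall_4 ray_nth)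
  then show ?thesis using that by blast
next
  case False
  define k where "k = (v$4 - v$3) / 2"
  have k: "k \<noteq> 0" "v$4 = v$3 + 2 * k" unfolding k_def using False two_ne_0
    by (simp_all add: divide_simps)
  define a b where "a = v$1 / (2 * k)" and "b = v$2 / (2 * k)"
  have ab: "v$1 = 2 * k * a" "v$2 = 2 * k * b" unfolding a_def b_def using k two_ne_0 by auto
  have "4 * k * (v$3 - k * (a * a + b * b - 1)) = mink v v"
    unfolding mink_def k ab by (simp add: algebra_simps)
  then have v3: "v$3 = k * (a * a + b * b - 1)" using assms k four_ne_0 by simp
  have "v = k *s ray (Some (a, b))"
    by (simp add: vec_eq_iff forall_4 ray_nth ab v3 k) (simp add: algebra_simps)
  then show ?thesis using that by blast
qed

text \<open>If \<open>x$4 = x$3\<close>, the circle passes through \<open>None\<close> and is an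
  affine line plus that point. Otherwise completing the square turns it into a Euclidean circle
  centred at (x1/w, x2/w), and \<open>card_circle\<close> applies.\<close>

lemma card_perp:
  fixes x :: "'a ^ 4"
  assumes "mink x x \<noteq> 0"
  shows "card (perp x) = CARD('a) + 1"
proof (cases "x$4 = x$3")
  case True
  have nz: "x$1 \<noteq> 0 \<or> x$2 \<noteq> 0"
    using assms True unfolding mink_def by auto
  define c where "c = x$3"
  have mem: "Some (a, b) \<in> perp x \<longleftrightarrow> a * x$1 + b * x$2 = c" for a b
  proof -
    have "mink x (ray (Some (a, b))) = 2 * (c - (a * x$1 + b * x$2))"
      unfolding mink_ray True c_def by (simp add: algebra_simps)
    then have "mink x (ray (Some (a, b))) = 0 \<longleftrightarrow> c - (a * x$1 + b * x$2) = 0"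
      using two_ne_0 by (simp only: mult_eq_0_iff) simp
    then show ?thesis unfolding perp_def by auto
  qed
  have "\<exists>h::'a \<Rightarrow> 'a \<times> 'a. inj h \<and> range h = {(a, b). a * x$1 + b * x$2 = c}"
  proof (cases "x$1 = 0")
    case True
    then have "x$2 \<noteq> 0" using nz by simp
    then show ?thesis using True
      by (intro exI[of _ "\<lambda>a. (a, c / x$2)"]) (auto intro!: injI simp: field_simps)
  next
    case False
    then show ?thesis
      by (intro exI[of _ "\<lambda>b. ((c - b * x$2) / x$1, b)"]) (auto intro!: injI simp: field_simps image_iff)
  qed
  then obtain h :: "'a \<Rightarrow> 'a \<times> 'a" where h: "inj h" "range h = {(a, b). a * x$1 + b * x$2 = c}" by blast
  have "p \<in> perp x \<longleftrightarrow> p \<in> insert None (Some ` range h)" for p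
    using mem True h(2) by (cases p) (auto simp: perp_def mink_ray)
  then have "perp x = insert None (Some ` range h)" by blast
  moreover have "card (Some ` range h) = CARD('a)"
    using h(1) by (simp add: card_image)
  ultimately show ?thesis by simp
next
  case False
  define w where "w = x$4 - x$3"
  have w: "w \<noteq> 0" "x$4 = x$3 + w" using False unfolding w_def by auto
  define r where "r = - mink x x / (w * w)"
  have r: "r \<noteq> 0" unfolding r_def using assms w by simp
  define h where "h = (\<lambda>(a, b). Some (a + x$1 / w, b + x$2 / w))"
  have mem: "Some (a + x$1 / w, b + x$2 / w) \<in> perp x \<longleftrightarrow> a * a + b * b = r" for a b
  proof -
    have "w * mink x (ray (Some (a + x$1 / w, b + x$2 / w))) = (w * w) * (a * a + b * b) + mink x x"
      unfolding mink_ray unfolding mink_def w(2) using w(1)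
      by (simp add: divide_simps) (simp add: algebra_simps)
    also have "\<dots> = (w * w) * (a * a + b * b - r)"
      unfolding r_def using w(1) by (simp add: algebra_simps)
    finally have "mink x (ray (Some (a + x$1 / w, b + x$2 / w))) = 0 \<longleftrightarrow> a * a + b * b - r = 0"
      using w(1) by (metis mult_eq_0_iff)
    then show ?thesis unfolding perp_def by simp
  qed
  have "p \<in> perp x \<longleftrightarrow> p \<in> h ` circle r" for p
  proof (cases p)
    case None
    then show ?thesis using False by (auto simp: perp_def mink_ray h_def)
  next
    case (Some c)
    obtain a b where c: "c = (a, b)" by fastforce
    have "p = h (a - x$1 / w, b - x$2 / w)" using Some c unfolding h_def by simp
    moreover have "inj h" unfolding h_def by (auto intro!: injI)
    moreover have "p \<in> perp x \<longleftrightarrow> (a - x$1 / w, b - x$2 / w) \<in> circle r"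
      using mem[of "a - x$1 / w" "b - x$2 / w"] Some c unfolding circle_def by simp
    ultimately show ?thesis by (simp add: inj_image_mem_iff)
  qed
  then have "perp x = h ` circle r" by blast
  moreover have "inj_on h (circle r)" unfolding h_def by (auto intro!: inj_onI)
  ultimately show ?thesis using card_circle[OF r] by (simp add: card_image)
qed

lemma obtain_perp_avoiding:
  fixes x :: "'a ^ 4"
  assumes "mink x x \<noteq> 0" "card S \<le> 7"
  obtains u where "u \<in> perp x" "u \<notin> S"
proof -
  have "\<not> perp x \<subseteq> S"
  proof
    assume "perp x \<subseteq> S"
    then have "card (perp x) \<le> card S" by (simp add: card_mono)
    then show False using card_perp[OF assms(1)] assms(2) card_ge by simp
  qed
  then show ?thesis using that by blast
qed

text \<open>Three distinct null directions in the orthogonal complement of \<open>x\<close>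
  span it, because any two of them are not orthogonal.\<close>

lemma three_perp_imp_parallel:
  fixes x y :: "'a ^ 4"
  assumes x: "mink x x \<noteq> 0"
    and ne: "u1 \<noteq> u2" "u1 \<noteq> u3" "u2 \<noteq> u3"
    and px: "{u1, u2, u3} \<subseteq> perp x" and py: "{u1, u2, u3} \<subseteq> perp y"
  shows "\<exists>k. y = k *s x"
proof -
  define z where "z = y - (mink x y / mink x x) *s x"
  let ?P = "ray u1" and ?R = "ray u2" and ?S = "ray u3"
  have X: "mink x ?P = 0" "mink x ?R = 0" "mink x ?S = 0"
    and Y: "mink y ?P = 0" "mink y ?R = 0" "mink y ?S = 0"
    using px py unfolding perp_def by auto
  have Z: "mink z x = 0" "mink z ?P = 0" "mink z ?R = 0" "mink z ?S = 0"
    unfolding z_def using X Y x by (auto simp: mink_linear mink_commute[of y x])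
  define p r s where "p = mink ?R ?S" and "r = mink ?P ?S" and "s = mink ?P ?R"
  have nz: "p \<noteq> 0" "r \<noteq> 0" "s \<noteq> 0" unfolding p_def r_def s_def mink_ray_ray using ne by auto
  have span: "a = 0 \<and> b = 0 \<and> c = 0 \<and> d = 0"
    if eq: "a *s x + b *s ?P + c *s ?R + d *s ?S = 0" for a b c d
  proof -
    let ?v = "a *s x + b *s ?P + c *s ?R + d *s ?S"
    have e: "mink ?v x = 0" "mink ?v ?P = 0" "mink ?v ?R = 0" "mink ?v ?S = 0"
      unfolding eq by (simp_all add: mink_linear)
    note sym = mink_commute[of ?P x] mink_commute[of ?R x] mink_commute[of ?S x]
      mink_commute[of ?R ?P] mink_commute[of ?S ?P] mink_commute[of ?S ?R]
    have "a = 0" using e(1) X x by (simp add: mink_linear sym)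
    have 1: "c * s + d * r = 0" using e(2) X by (simp add: mink_linear s_def r_def sym)
    have 2: "b * s + d * p = 0" using e(3) X by (simp add: mink_linear s_def p_def sym)
    have 3: "b * r + c * p = 0" using e(4) X by (simp add: mink_linear r_def p_def sym)
    \<comment> \<open>The Gram matrix of the three rays has zero diagonal and determinant 2 p r s;
      this combination of its rows isolates \<open>d\<close>.\<close>
    have "2 * (d * (p * r)) = r * (b * s + d * p) + p * (c * s + d * r) - s * (b * r + c * p)"
      by (simp add: algebra_simps)
    then have "d = 0" unfolding 1 2 3 using nz two_ne_0 by simp
    then show ?thesis using 1 2 nz \<open>a = 0\<close> by auto
  qed
  have "mink z w = 0" for w
  proof -
    obtain a b c d where "w = a *s x + b *s ?P + c *s ?R + d *s ?S"
      using inj_combination_spans[OF span] by blast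
    then show ?thesis using Z by (simp add: mink_linear)
  qed
  then have "z = 0" by (rule mink_nondegenerate)
  then show ?thesis unfolding z_def by (metis eq_iff_diff_eq_0)
qed

lemma perp_subset_imp_parallel:
  fixes x y :: "'a ^ 4"
  assumes x: "mink x x \<noteq> 0" and sub: "perp x \<subseteq> perp y"
  shows "\<exists>k. y = k *s x"
proof -
  obtain u1 where 1: "u1 \<in> perp x"
    using obtain_perp_avoiding[OF x, of "{}"] by auto
  obtain u2 where 2: "u2 \<in> perp x" "u2 \<noteq> u1"
    using obtain_perp_avoiding[OF x, of "{u1}"] by auto
  obtain u3 where 3: "u3 \<in> perp x" "u3 \<noteq> u1" "u3 \<noteq> u2"
    using obtain_perp_avoiding[OF x, of "{u1, u2}"] 2 by auto
  show ?thesis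
    by (rule three_perp_imp_parallel[OF x, of u1 u2 u3]) (use 1 2 3 sub in auto)
qed

end

lemma solve_linear:
  fixes a b k :: "'a::field"
  assumes "a + k * b = 0" "b \<noteq> 0"
  shows "k = - a / b"
proof -
  have "k * b = - a" using assms(1) by (metis add.commute eq_neg_iff_add_eq_0)
  then show ?thesis using assms(2) by (metis nonzero_mult_div_cancel_right)
qed

context minkowski_field
begin

abbreviation msq :: "'a ^ 4 \<Rightarrow> 'a" where
  "msq x \<equiv> mink x x"

lemma msq_diff: "msq (x - y) = msq x + msq y - 2 * mink x y"
  by (simp add: mink_linear mink_commute[of y x])

lemma msq_diff_commute: "msq (x - y) = msq (y - x)"
  by (simp add: mink_linear)

lemma msq_shift: "msq (x + k *s ray u) = msq x + 2 * k * mink x (ray u)"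
  by (simp add: mink_linear mink_commute[of "ray u" x])

lemma msq_shift_perp: "u \<in> perp x \<Longrightarrow> msq (x + k *s ray u) = msq x"
  by (simp add: msq_shift perp_def)

lemma perp_shift: "u \<in> perp (x + k *s ray u) \<longleftrightarrow> u \<in> perp x"
  by (simp add: perp_def mink_linear)

lemma null_diff:
  assumes "msq (y - x) = 0"
  obtains k u where "y = x + k *s ray u"
proof -
  obtain k u where "y - x = k *s ray u" using null_is_scaled_ray[OF assms] .
  then have "y = x + k *s ray u" by (simp add: algebra_simps)
  then show ?thesis using that by blast
qed

lemma msq_ray_diff: "msq (k *s ray u - l *s ray v) = 0 \<longleftrightarrow> k = 0 \<or> l = 0 \<or> u = v"
proof -
  have "msq (k *s ray u - l *s ray v) = - 2 * (k * (l * mink (ray u) (ray v)))"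
    by (simp add: mink_linear mink_commute[of "ray v"])
  then show ?thesis using two_ne_0 by (simp add: mink_ray_ray)
qed

text \<open>There are no null triangles: a difference of nonzero multiples of two rays is null only
  if the rays coincide.\<close>

lemma on_line_of_two:
  assumes "msq (z - p) = 0" "msq (z - (p + l *s ray v)) = 0" "l \<noteq> 0"
  shows "\<exists>m. z = p + m *s ray v"
proof -
  obtain m w where z: "z = p + m *s ray w" using null_diff[OF assms(1)] .
  have "msq (m *s ray w - l *s ray v) = 0" using assms(2) unfolding z by simp
  then show ?thesis using z \<open>l \<noteq> 0\<close> by (auto simp: msq_ray_diff)
qed

lemma null_point_on_line:
  assumes "mink (x - y) (ray u) \<noteq> 0"
  shows "\<exists>k. msq (x + k *s ray u - y) = 0"
proof -
  have "x + k *s ray u - y = (x - y) + k *s ray u" for k by simp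
  then show ?thesis
    using assms two_ne_0
    by (intro exI[of _ "- msq (x - y) / (2 * mink (x - y) (ray u))"]) (simp only: msq_shift, simp)
qed

lemma obtain_avoiding:
  assumes "length (xs :: 'a list) \<le> 6"
  obtains k where "k \<notin> set xs"
proof -
  have "set xs \<noteq> UNIV" using assms card_ge card_length[of xs] by auto
  then show ?thesis using that by blast
qed

lemma obtain_nonnull_shift:
  assumes "msq x \<noteq> 0"
  obtains k where "k \<noteq> 0" "msq (x + k *s ray u) \<noteq> 0"
proof -
  obtain k where k: "k \<notin> {0, - msq x / (2 * mink x (ray u))}"
    using obtain_avoiding[of "[0, - msq x / (2 * mink x (ray u))]"] by auto
  have "msq (x + k *s ray u) \<noteq> 0"
  proof
    assume "msq (x + k *s ray u) = 0"
    then have e: "msq x + k * (2 * mink x (ray u)) = 0" by (simp add: msq_shift mult.assoc mult.left_commute)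
    then have "2 * mink x (ray u) \<noteq> 0" using assms by auto
    then have "k = - msq x / (2 * mink x (ray u))" using e by (intro solve_linear)
    then show False using k by simp
  qed
  then show ?thesis using that k by blast
qed

section \<open>Spheres are connected by null lines\<close>

text \<open>If every tangent direction at \<open>x\<close> were tangent at \<open>y\<close>, then
  \<open>y\<close> would be a multiple of \<open>x\<close> with factor 1 or -1. Otherwise a tangent
  line at \<open>x\<close> not orthogonal to \<open>y\<close> contains a point null-separated from
  \<open>y\<close>, and the joining line is tangent since both ends are on the sphere.\<close>

lemma two_step_path:
  assumes "msq x \<noteq> 0" "msq y = msq x" "y \<noteq> x" "y \<noteq> - x"
  obtains u k v l where "u \<in> perp x" "v \<in> perp (x + k *s ray u)" "y = x + k *s ray u + l *s ray v"
proof -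
  have "\<not> perp x \<subseteq> perp y"
  proof
    assume "perp x \<subseteq> perp y"
    then obtain c where c: "y = c *s x" using perp_subset_imp_parallel assms(1) by blast
    then have "c * c * msq x = msq x" using assms(2) by (simp add: mink_linear mult.assoc)
    then have "c * c = 1" using assms(1) by simp
    then have "c = 1 \<or> c = - 1" by (simp add: square_eq_1_iff)
    then show False using c assms(3,4) by auto
  qed
  then obtain u where u: "u \<in> perp x" "u \<notin> perp y" by blast
  then have "mink (x - y) (ray u) \<noteq> 0" by (simp add: perp_def mink_linear)
  then obtain k where "msq (x + k *s ray u - y) = 0" using null_point_on_line by blast
  then have "msq (y - (x + k *s ray u)) = 0" by (simp only: msq_diff_commute)
  then obtain l v where y: "y = x + k *s ray u + l *s ray v" by (rule null_diff)
  have "2 * l * mink (x + k *s ray u) (ray v) = 0"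
    using assms(2) msq_shift[of "x + k *s ray u" l v] msq_shift_perp[OF u(1)] y by simp
  then have "l = 0 \<or> v \<in> perp (x + k *s ray u)" using two_ne_0 unfolding perp_def by auto
  then show ?thesis
  proof
    assume "l = 0"
    then show ?thesis using that[of u u k 0] u(1) y perp_shift[of u x k] by simp
  qed (use that u y in blast)
qed

lemma sphere_induct:
  assumes x: "msq x \<noteq> 0" "P x" and z: "msq z = msq x"
    and step: "\<And>y u k. msq y = msq x \<Longrightarrow> P y \<Longrightarrow> u \<in> perp y \<Longrightarrow> P (y + k *s ray u)"
  shows "P z"
proof -
  have two: "P w" if wy: "msq w = msq x" "msq y = msq x" "P y" "w \<noteq> - y" for y w
  proof (cases "w = y")
    case False
    then obtain u k v l where p: "u \<in> perp y" "v \<in> perp (y + k *s ray u)" "w = y + k *s ray u + l *s ray v"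
      using two_step_path[of y w] wy x(1) by metis
    then have "P (y + k *s ray u)" "msq (y + k *s ray u) = msq x"
      using step[of y u k] wy msq_shift_perp by auto
    then show ?thesis using step[of "y + k *s ray u" v l] p by simp
  qed (use that in simp)
  show ?thesis
  proof (cases "z = - x")
    case True
    \<comment> \<open>The antipode is not covered by a two-step path from \<open>x\<close>, but it
      is from any neighbour of \<open>x\<close>, whose own antipode is different.\<close>
    obtain u where u: "u \<in> perp x" using obtain_perp_avoiding[OF x(1), of "{}"] by auto
    let ?w = "x + 1 *s ray u"
    have "P ?w" "msq ?w = msq x" using step[of x u 1] x u msq_shift_perp[OF u, of 1] by auto
    moreover have "- x \<noteq> - ?w" using ray_ne_0[of u] by simp
    ultimately show ?thesis using two[of z ?w] z True by auto
  qed (use two[of z x] x z in auto)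
qed

end

section \<open>The action on null lines\<close>

text \<open>\<open>\<phi>\<close> is total, but nothing is known about it on the cone; hence the
  recurring checks that shifted points are nonnull.\<close>

locale light_speed_map = minkowski_field "TYPE('a)" for \<phi> :: "'a::{field,finite} ^ 4 \<Rightarrow> 'a ^ 4" +
  assumes nonnull: "\<And>x. mink x x \<noteq> 0 \<Longrightarrow> mink (\<phi> x) (\<phi> x) \<noteq> 0"
    and adjacent: "\<And>x y. mink x x \<noteq> 0 \<Longrightarrow> mink y y \<noteq> 0 \<Longrightarrow> x \<noteq> y \<Longrightarrow> mink (x - y) (x - y) = 0
      \<Longrightarrow> mink (\<phi> x - \<phi> y) (\<phi> x - \<phi> y) = 0 \<and> \<phi> x \<noteq> \<phi> y"
begin

lemma adjacent_shifts:
  assumes "msq (x + j *s ray u) \<noteq> 0" "msq (x + k *s ray u) \<noteq> 0" "j \<noteq> k"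
  shows "msq (\<phi> (x + j *s ray u) - \<phi> (x + k *s ray u)) = 0"
    "\<phi> (x + j *s ray u) \<noteq> \<phi> (x + k *s ray u)"
proof -
  have d: "x + j *s ray u - (x + k *s ray u) = (j - k) *s ray u"
    by (simp add: vector_sub_rdistrib)
  have "(j - k) *s ray u \<noteq> 0" using assms(3) ray_ne_0 by simp
  then have "x + j *s ray u \<noteq> x + k *s ray u" using d by (metis right_minus_eq)
  moreover have "msq (x + j *s ray u - (x + k *s ray u)) = 0" unfolding d by (simp add: mink_linear)
  ultimately show "msq (\<phi> (x + j *s ray u) - \<phi> (x + k *s ray u)) = 0"
    "\<phi> (x + j *s ray u) \<noteq> \<phi> (x + k *s ray u)"
    using adjacent assms by blast+
qed

lemma adjacent_shift:
  assumes "msq x \<noteq> 0" "msq (x + k *s ray u) \<noteq> 0" "k \<noteq> 0"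
  shows "msq (\<phi> (x + k *s ray u) - \<phi> x) = 0" "\<phi> (x + k *s ray u) \<noteq> \<phi> x"
  using adjacent_shifts[of x k u 0] assms by simp_all

text \<open>Images of points of a null line are pairwise adjacent, so the image of one second point
  fixes a null line that contains all the others.\<close>

lemma line_image:
  assumes x: "msq x \<noteq> 0"
  shows "\<exists>v. \<forall>k. msq (x + k *s ray u) \<noteq> 0 \<longrightarrow> (\<exists>l. \<phi> (x + k *s ray u) = \<phi> x + l *s ray v)"
proof -
  have step: "\<exists>l v. \<phi> (x + k *s ray u) = \<phi> x + l *s ray v" if "msq (x + k *s ray u) \<noteq> 0" for k
  proof (cases "k = 0")
    case True
    then show ?thesis by (intro exI[of _ 0]) simp
  next
    case False
    then show ?thesis using adjacent_shift(1)[OF x that] by (metis null_diff)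
  qed
  obtain k where k: "k \<noteq> 0" "msq (x + k *s ray u) \<noteq> 0" using obtain_nonnull_shift[OF x] .
  obtain l v where l: "\<phi> (x + k *s ray u) = \<phi> x + l *s ray v" using step[OF k(2)] by blast
  have "l \<noteq> 0" using adjacent_shift(2)[OF x k(2,1)] l by auto
  have "\<exists>l. \<phi> (x + j *s ray u) = \<phi> x + l *s ray v" if j: "msq (x + j *s ray u) \<noteq> 0" for j
  proof -
    obtain m w where m: "\<phi> (x + j *s ray u) = \<phi> x + m *s ray w" using step[OF j] by blast
    consider "j = 0" | "j = k" | "j \<noteq> 0" "j \<noteq> k" by blast
    then show ?thesis
    proof cases
      case 1
      then show ?thesis by (intro exI[of _ 0]) simp
    next
      case 2
      then show ?thesis using l by blast
    next
      case 3
      then have "msq (\<phi> (x + j *s ray u) - \<phi> (x + k *s ray u)) = 0"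
        using adjacent_shifts(1) j k(2) by blast
      then have "msq (m *s ray w - l *s ray v) = 0" unfolding m l by simp
      then show ?thesis using m \<open>l \<noteq> 0\<close>
        by (auto simp: msq_ray_diff intro: exI[of _ 0])
    qed
  qed
  then show ?thesis by blast
qed

text \<open>The direction of the image line. It makes sense for every \<open>u\<close>, also when
  the line leaves the sphere and crosses the cone; \<open>spheres_disjoint\<close> uses that
  case.\<close>

definition dir :: "'a ^ 4 \<Rightarrow> ('a \<times> 'a) option \<Rightarrow> ('a \<times> 'a) option" where
  "dir x u = (SOME v. \<forall>k. msq (x + k *s ray u) \<noteq> 0 \<longrightarrow> (\<exists>l. \<phi> (x + k *s ray u) = \<phi> x + l *s ray v))"

lemma dir:
  assumes "msq x \<noteq> 0" "msq (x + k *s ray u) \<noteq> 0"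
  obtains l where "\<phi> (x + k *s ray u) = \<phi> x + l *s ray (dir x u)" "l = 0 \<longleftrightarrow> k = 0"
proof -
  obtain l where l: "\<phi> (x + k *s ray u) = \<phi> x + l *s ray (dir x u)"
    using someI_ex[OF line_image[OF assms(1), of u]] assms(2) unfolding dir_def by blast
  have "l = 0 \<longleftrightarrow> k = 0"
  proof (cases "k = 0")
    case True
    then show ?thesis using l by (simp add: ray_ne_0)
  next
    case False
    then show ?thesis using adjacent_shift(2)[OF assms] l by auto
  qed
  then show ?thesis using that l by blast
qed

lemma dir_unique:
  assumes "msq x \<noteq> 0" "msq (x + k *s ray u) \<noteq> 0" "k \<noteq> 0" "\<phi> (x + k *s ray u) = \<phi> x + l *s ray v"
  shows "dir x u = v"
proof -
  obtain m where m: "\<phi> (x + k *s ray u) = \<phi> x + m *s ray (dir x u)" "m \<noteq> 0"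
    using dir[OF assms(1,2)] assms(3) by metis
  then have "m *s ray (dir x u) = l *s ray v" using assms(4) by simp
  then show ?thesis using scaled_ray_eq m(2) by blast
qed

lemma dir_shift:
  assumes "msq x \<noteq> 0" "msq (x + k *s ray u) \<noteq> 0"
  shows "dir (x + k *s ray u) u = dir x u"
proof (cases "k = 0")
  case False
  obtain l where l: "\<phi> (x + k *s ray u) = \<phi> x + l *s ray (dir x u)" using dir[OF assms] by metis
  show ?thesis
  proof (rule dir_unique[OF assms(2)])
    show "- k \<noteq> 0" using False by simp
    show "msq (x + k *s ray u + (- k) *s ray u) \<noteq> 0"
      using assms(1) by (simp add: vector_sneg_minus1[symmetric])
    show "\<phi> (x + k *s ray u + (- k) *s ray u) = \<phi> (x + k *s ray u) + (- l) *s ray (dir x u)"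
      unfolding l by (simp add: vector_sneg_minus1[symmetric])
  qed
qed simp

lemma shift_inj:
  assumes "msq x \<noteq> 0" "msq (x + k *s ray u) \<noteq> 0" "msq (x + l *s ray u) \<noteq> 0"
    and "\<phi> (x + k *s ray u) = \<phi> (x + l *s ray u)"
  shows "k = l"
  using adjacent_shifts(2) assms by blast

text \<open>A tangent line avoids the cone, so all its q points have different images on a line with
  q points.\<close>

lemma full_line_onto:
  assumes x: "msq x \<noteq> 0" and u: "u \<in> perp x"
  shows "\<exists>k. \<phi> (x + k *s ray u) = \<phi> x + l *s ray (dir x u)"
proof -
  have nn: "msq (x + k *s ray u) \<noteq> 0" for k using msq_shift_perp[OF u] x by simp
  have "\<forall>k. \<exists>l. \<phi> (x + k *s ray u) = \<phi> x + l *s ray (dir x u)" using dir[OF x nn] by metis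
  then obtain f where f: "\<And>k. \<phi> (x + k *s ray u) = \<phi> x + f k *s ray (dir x u)" by metis
  have "inj f"
    by (rule injI) (use f shift_inj[OF x nn nn] in metis)
  then have "surj f" by (simp add: finite_UNIV_inj_surj)
  then show ?thesis using f by (metis surjD)
qed

text \<open>A null line not tangent to the sphere of \<open>\<phi> x\<close> would contain a null
  vector, which would be hit because the line is covered completely.\<close>

lemma dir_perp:
  assumes x: "msq x \<noteq> 0" and u: "u \<in> perp x"
  shows "dir x u \<in> perp (\<phi> x)"
proof (rule ccontr)
  let ?m = "mink (\<phi> x) (ray (dir x u))"
  assume "dir x u \<notin> perp (\<phi> x)"
  then have m: "?m \<noteq> 0" unfolding perp_def by simp
  obtain k where k: "\<phi> (x + k *s ray u) = \<phi> x + (- msq (\<phi> x) / (2 * ?m)) *s ray (dir x u)"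
    using full_line_onto[OF assms] by blast
  have "msq (\<phi> (x + k *s ray u)) = 0"
    unfolding k msq_shift using m two_ne_0 by simp
  then show False using nonnull msq_shift_perp[OF u] x by simp
qed

lemma msq_image_shift:
  assumes x: "msq x \<noteq> 0" and u: "u \<in> perp x"
  shows "msq (\<phi> (x + k *s ray u)) = msq (\<phi> x)"
proof -
  obtain l where "\<phi> (x + k *s ray u) = \<phi> x + l *s ray (dir x u)"
    using dir[OF x, of k u] msq_shift_perp[OF u] x by metis
  then show ?thesis using msq_shift_perp[OF dir_perp[OF assms]] by simp
qed

lemma sphere_image:
  assumes "msq x \<noteq> 0" "msq y = msq x"
  shows "msq (\<phi> y) = msq (\<phi> x)"
  by (rule sphere_induct[where P = "\<lambda>y. msq (\<phi> y) = msq (\<phi> x)", OF assms(1) refl assms(2)])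
    (use assms msq_image_shift in auto)

section \<open>A map that is not locally injective on a sphere is a colouring\<close>

text \<open>Generalized quadrangle argument: a point \<open>?y\<close> on the line through
  \<open>?a\<close> in direction \<open>w\<close> is adjacent or equal to a point \<open>?b\<close>
  of the second line through \<open>x\<close>. The images of \<open>?a\<close> and \<open>?b\<close>
  are different points of one line, so the image of \<open>?y\<close> lies on it too.\<close>

lemma collapse_step:
  assumes x: "msq x \<noteq> 0" and u: "u1 \<in> perp x" "u2 \<in> perp x" "u1 \<noteq> u2"
    and v: "dir x u1 = v" "dir x u2 = v"
    and k: "k \<noteq> 0" and w: "w \<in> perp (x + k *s ray u1)"
  shows "dir (x + k *s ray u1) w = v"
proof (cases "w = u1")
  case True
  then show ?thesis using dir_shift[OF x] msq_shift_perp[OF u(1)] x v by simp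
next
  case False
  let ?a = "x + k *s ray u1"
  define b12 b1 b2 where "b12 = mink (ray u1) (ray u2)" and "b1 = mink (ray u1) (ray w)"
    and "b2 = mink (ray w) (ray u2)"
  have b: "b12 \<noteq> 0" "b1 \<noteq> 0" unfolding b12_def b1_def mink_ray_ray using u(3) False by auto
  have a: "msq ?a \<noteq> 0" using msq_shift_perp[OF u(1)] x by simp
  have nn2: "msq (x + t *s ray u2) \<noteq> 0" for t using msq_shift_perp[OF u(2)] x by simp
  obtain la where la: "\<phi> ?a = \<phi> x + la *s ray v" "la \<noteq> 0" using dir[OF x a] k v by metis
  obtain ta where ta: "\<phi> (x + ta *s ray u2) = \<phi> ?a"
    using full_line_onto[OF x u(2), of la] la v by metis
  have "ta \<noteq> 0"
  proof
    assume "ta = 0"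
    then have "la *s ray v = 0" using ta la by simp
    then show False using la(2) ray_ne_0 by simp
  qed
  \<comment> \<open>The three values are those with \<open>?y = ?a\<close>, with no usable
    \<open>?b\<close> (\<open>D = 0\<close>), and with \<open>?b\<close> having the same image as
    \<open>?a\<close> (\<open>t = ta\<close>). A vanishing denominator yields the value 0, which is
    excluded anyway.\<close>
  obtain s where s: "s \<notin> {0, - (k * b12) / b2, ta * k * b12 / (k * b1 - ta * b2)}"
    using obtain_avoiding[of "[0, - (k * b12) / b2, ta * k * b12 / (k * b1 - ta * b2)]"] by auto
  define D where "D = k * b12 + s * b2"
  have D: "D \<noteq> 0"
  proof
    assume D0: "D = 0"
    then have "b2 \<noteq> 0" unfolding D_def using k b by auto
    then have "s = - (k * b12) / b2" using D0 unfolding D_def by (intro solve_linear)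
    then show False using s by simp
  qed
  define t where "t = k * s * b1 / D"
  have tD: "t * D = k * s * b1" unfolding t_def using D by simp
  have "t \<noteq> ta"
  proof
    assume "t = ta"
    then have e: "s * (k * b1 - ta * b2) = ta * k * b12"
      using tD unfolding D_def by (simp add: algebra_simps)
    then have "k * b1 - ta * b2 \<noteq> 0" using \<open>ta \<noteq> 0\<close> k b by auto
    then have "s = ta * k * b12 / (k * b1 - ta * b2)" using e by (simp add: nonzero_eq_divide_eq)
    then show False using s by simp
  qed
  let ?y = "?a + s *s ray w" and ?b = "x + t *s ray u2"
  have y: "msq ?y \<noteq> 0" using msq_shift_perp[OF w] a by simp
  have yb: "msq (?y - ?b) = 0"
  proof -
    have "?y - ?b = k *s ray u1 + s *s ray w - t *s ray u2" by simp
    then have "msq (?y - ?b) = 2 * (k * s * b1 - t * D)"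
      unfolding D_def b12_def b1_def b2_def
      by (simp add: mink_linear mink_commute[of "ray w" "ray u1"] mink_commute[of "ray u2"] algebra_simps)
    then show ?thesis using tD by simp
  qed
  have ya: "msq (\<phi> ?y - \<phi> ?a) = 0" using adjacent_shift(1)[OF a y] s by simp
  obtain lb where lb: "\<phi> ?b = \<phi> x + lb *s ray v" using dir[OF x nn2] v by metis
  have "lb \<noteq> la" using shift_inj[OF x nn2 nn2, of t ta] lb la ta \<open>t \<noteq> ta\<close> by auto
  have bb: "\<phi> ?b = \<phi> ?a + (lb - la) *s ray v"
    unfolding lb la by (simp add: vector_sub_rdistrib)
  have "\<exists>m. \<phi> ?y = \<phi> ?a + m *s ray v"
  proof (cases "?y = ?b")
    case True
    then show ?thesis using bb by metis
  next
    case False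
    then have "msq (\<phi> ?y - \<phi> ?b) = 0" using adjacent[OF y nn2 _ yb] by blast
    moreover have "lb - la \<noteq> 0" using \<open>lb \<noteq> la\<close> by simp
    ultimately show ?thesis unfolding bb using on_line_of_two[OF ya] by blast
  qed
  then show ?thesis using dir_unique[OF a y] s by auto
qed

lemma collapse_sphere:
  assumes x: "msq x \<noteq> 0" and u: "u1 \<in> perp x" "u2 \<in> perp x" "u1 \<noteq> u2"
    and d: "dir x u1 = dir x u2" and z: "msq z = msq x"
  shows "\<exists>l. \<phi> z = \<phi> x + l *s ray (dir x u1)"
proof -
  define v where "v = dir x u1"
  \<comment> \<open>The claim is strengthened to all tangent directions, so that
    \<open>collapse_step\<close> can pass it on. The induction starts at the neighbour
    \<open>?a\<close>, since at \<open>x\<close> only two directions are known to coincide.\<close>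
  define P where "P z \<longleftrightarrow> (\<forall>w\<in>perp z. dir z w = v) \<and> (\<exists>l. \<phi> z = \<phi> x + l *s ray v)" for z
  let ?a = "x + 1 *s ray u1"
  have a: "msq ?a = msq x" using msq_shift_perp[OF u(1)] .
  have Pa: "P ?a"
  proof -
    have "dir ?a w = v" if "w \<in> perp ?a" for w
      by (rule collapse_step[OF x u]) (use v_def d that in auto)
    moreover obtain l where "\<phi> ?a = \<phi> x + l *s ray v" using dir[OF x, of 1 u1] a x v_def by metis
    ultimately show ?thesis unfolding P_def by blast
  qed
  have "P z"
  proof (rule sphere_induct[of ?a])
    fix y w k
    assume y: "msq y = msq ?a" and P: "P y" and w: "w \<in> perp y"
    have y0: "msq y \<noteq> 0" using y a x by simp
    show "P (y + k *s ray w)"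
    proof (cases "k = 0")
      case False
      obtain w2 where w2: "w2 \<in> perp y" "w2 \<noteq> w"
        using obtain_perp_avoiding[OF y0, of "{w}"] by auto
      have 1: "dir (y + k *s ray w) w' = v" if "w' \<in> perp (y + k *s ray w)" for w'
        by (rule collapse_step[OF y0 w w2(1)]) (use P w w2 that False in \<open>auto simp: P_def\<close>)
      obtain l where "\<phi> y = \<phi> x + l *s ray v" using P unfolding P_def by blast
      moreover obtain m where "\<phi> (y + k *s ray w) = \<phi> y + m *s ray v"
        using dir[OF y0, of k w] msq_shift_perp[OF w] y0 P w unfolding P_def by metis
      ultimately have "\<phi> (y + k *s ray w) = \<phi> x + (l + m) *s ray v"
        by (simp add: vec.scale_left_distrib)
      then show ?thesis using 1 unfolding P_def by blast
    qed (use P in simp)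
  qed (use Pa a x z in auto)
  then show ?thesis unfolding P_def v_def by blast
qed

end

section \<open>Counts of directions and of points in hyperplanes\<close>

context minkowski_field
begin

lemma card_directions: "CARD(('a \<times> 'a) option) = CARD('a) * CARD('a) + 1"
  by (simp add: card_option card_prod)

lemma obtain_not_perp:
  assumes "msq y \<noteq> 0"
  obtains u where "u \<notin> perp y"
proof -
  have "perp y \<noteq> UNIV"
  proof
    assume "perp y = UNIV"
    then have "CARD('a) * CARD('a) = CARD('a)"
      using card_perp[OF assms] card_directions by simp
    then show False using card_ge by simp
  qed
  then show ?thesis using that by blast
qed

lemma square_eq_imp:
  fixes a b :: 'a
  shows "a * a = b * b \<Longrightarrow> a = b \<or> a = - b"
  by (simp add: square_eq_iff)

lemma card_hyperplane:
  assumes "v \<noteq> (0 :: 'a ^ 4)"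
  shows "card {z. mink z v = c} = CARD('a) ^ 3"
proof -
  obtain w where w: "mink w v \<noteq> 0" using mink_nondegenerate[of v] assms mink_commute by metis
  define s where "s = (1 / mink w v) *s w"
  have s: "mink s v = 1" unfolding s_def using w by (simp add: mink_linear)
  let ?H = "\<lambda>c. {z. mink z v = c}"
  have eq: "card (?H a) = card (?H c)" for a
  proof (rule bij_betw_same_card)
    show "bij_betw (\<lambda>z. z + (c - a) *s s) (?H a) (?H c)"
      by (rule bij_betw_byWitness[where f' = "\<lambda>z. z - (c - a) *s s"]) (auto simp: mink_linear s)
  qed
  have "CARD('a ^ 4) = card (\<Union>a\<in>UNIV. ?H a)" by (rule arg_cong[where f = card]) auto
  also have "\<dots> = (\<Sum>a\<in>UNIV. card (?H a))" by (rule card_UN_disjoint) auto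
  also have "\<dots> = (\<Sum>a\<in>(UNIV :: 'a set). card (?H c))" by (rule sum.cong[OF refl eq])
  also have "\<dots> = CARD('a) * card (?H c)" by simp
  finally have "CARD('a) ^ 4 = CARD('a) * card (?H c)" by simp
  then have "CARD('a) * CARD('a) ^ 3 = CARD('a) * card (?H c)" by (simp add: power_Suc[symmetric] del: power_Suc)
  then show ?thesis using card_ge by simp
qed

end

context light_speed_map
begin

text \<open>An image off the line is adjacent to at most one point of it, so all neighbours of
  \<open>y\<close> on the sphere share one image. Sphere points with this image that are not
  adjacent to \<open>y\<close> are proportional to \<open>y\<close>, with a factor of prescribed
  square. Three different such points are constructed, but only two factors exist.\<close>

lemma collapse_all:
  assumes x0: "msq x0 \<noteq> 0" and coll: "\<And>z. msq z = msq x0 \<Longrightarrow> \<exists>l. \<phi> z = p + l *s ray v"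
    and y: "msq y \<noteq> 0"
  shows "\<exists>l. \<phi> y = p + l *s ray v"
proof (rule ccontr)
  assume off: "\<nexists>l. \<phi> y = p + l *s ray v"
  then have ne: "msq y \<noteq> msq x0" using coll by blast
  have mono: "\<phi> x1 = \<phi> x2"
    if 1: "msq x1 = msq x0" "msq (x1 - y) = 0" and 2: "msq x2 = msq x0" "msq (x2 - y) = 0" for x1 x2
  proof (rule ccontr)
    assume "\<phi> x1 \<noteq> \<phi> x2"
    obtain l1 l2 where l: "\<phi> x1 = p + l1 *s ray v" "\<phi> x2 = p + l2 *s ray v"
      using coll 1 2 by blast
    have l': "\<phi> x2 = \<phi> x1 + (l2 - l1) *s ray v" "l2 - l1 \<noteq> 0"
      using l \<open>\<phi> x1 \<noteq> \<phi> x2\<close> by (auto simp: vector_sub_rdistrib)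
    have "x1 \<noteq> y" "x2 \<noteq> y" using 1 2 ne by auto
    then have "msq (\<phi> y - \<phi> x1) = 0" "msq (\<phi> y - \<phi> x2) = 0"
      using adjacent[of y x1] adjacent[of y x2] 1 2 x0 y by (metis msq_diff_commute)+
    then obtain m where "\<phi> y = \<phi> x1 + m *s ray v" using on_line_of_two l' by metis
    then have "\<phi> y = p + (l1 + m) *s ray v" unfolding l by (simp add: vec.scale_left_distrib)
    then show False using off by blast
  qed
  obtain u0 where u0: "u0 \<notin> perp y" using obtain_not_perp[OF y] .
  define k0 where "k0 = (msq x0 - msq y) / (2 * mink y (ray u0))"
  define x1 where "x1 = y + k0 *s ray u0"
  have "2 * mink y (ray u0) \<noteq> 0" using u0 two_ne_0 by (simp add: perp_def)
  then have "k0 * (2 * mink y (ray u0)) = msq x0 - msq y"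
    unfolding k0_def by (metis nonzero_divide_eq_eq)
  then have x1: "msq x1 = msq x0" "msq (x1 - y) = 0"
    unfolding x1_def by (simp add: msq_shift mult.assoc mult.left_commute) (simp add: mink_linear)
  \<comment> \<open>A tangent line at \<open>x\<close> not orthogonal to \<open>y\<close> would
    contain a neighbour of \<open>y\<close> other than \<open>x\<close>, with the same image as
    \<open>x\<close>, against adjacency.\<close>
  have par: "\<exists>m. y = m *s x" if x: "msq x = msq x0" "\<phi> x = \<phi> x1" "msq (x - y) \<noteq> 0" for x
  proof (rule perp_subset_imp_parallel)
    show "msq x \<noteq> 0" using x x0 by simp
    show "perp x \<subseteq> perp y"
    proof
      fix u assume u: "u \<in> perp x"
      show "u \<in> perp y"
      proof (rule ccontr)
        assume "u \<notin> perp y"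
        then have "mink (x - y) (ray u) \<noteq> 0" using u by (simp add: perp_def mink_linear)
        then obtain k where k: "msq (x + k *s ray u - y) = 0" using null_point_on_line by blast
        have nn: "msq (x + k *s ray u) = msq x0" using msq_shift_perp[OF u] x by simp
        then have "\<phi> (x + k *s ray u) = \<phi> x" using mono[OF nn k x1] x by simp
        moreover have "k \<noteq> 0" using k x(3) by auto
        ultimately show False using adjacent_shift(2)[of x k u] nn x x0 by simp
      qed
    qed
  qed
  obtain u where u: "u \<in> perp y" using obtain_perp_avoiding[OF y, of "{}"] by auto
  obtain z where z: "msq z = msq x0" "u \<notin> perp z"
  proof (cases "u \<in> perp x0")
    case True
    obtain w where w: "w \<in> perp x0" "w \<noteq> u" using obtain_perp_avoiding[OF x0, of "{u}"] by auto
    have "mink (x0 + 1 *s ray w) (ray u) \<noteq> 0"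
      using True w(2) mink_ray_ray by (simp add: mink_linear perp_def)
    then show ?thesis using that[of "x0 + 1 *s ray w"] msq_shift_perp[OF w(1), of 1] by (simp add: perp_def)
  qed (use that in blast)
  have z0: "msq z \<noteq> 0" using z x0 by simp
  \<comment> \<open>The tangent line at \<open>z\<close> in direction \<open>w\<close> has a point
    orthogonal to \<open>u\<close>, and the line from there in direction \<open>u\<close> covers the
    image line, so it contains a point with the image of \<open>x1\<close>. Since \<open>u\<close>
    is orthogonal to \<open>y\<close> as well, adjacency of this point to \<open>y\<close> would
    spread along the line and force equal images.\<close>
  have rep: "\<exists>m k t. k \<noteq> 0 \<and> y = m *s (z + k *s ray w + t *s ray u)
      \<and> msq (z + k *s ray w + t *s ray u) = msq x0" if w: "w \<in> perp z" for w
  proof -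
    have "w \<noteq> u" using w z by auto
    then have wu: "mink (ray w) (ray u) \<noteq> 0" using mink_ray_ray by blast
    define k where "k = - mink z (ray u) / mink (ray w) (ray u)"
    define x where "x = z + k *s ray w"
    have x: "msq x = msq x0" unfolding x_def using msq_shift_perp[OF w] z by simp
    have ux: "u \<in> perp x" unfolding x_def k_def perp_def using wu by (simp add: mink_linear)
    have x0': "msq x \<noteq> 0" using x x0 by simp
    obtain l1 where l1: "\<phi> x1 = p + l1 *s ray v" using coll x1 by blast
    obtain l2 where l2: "\<phi> x = p + l2 *s ray v" using coll x by blast
    have xu: "msq (x + j *s ray u) = msq x0" for j using msq_shift_perp[OF ux] x by simp
    obtain l3 where l3: "\<phi> (x + 1 *s ray u) = p + l3 *s ray v" using coll xu by blast
    have "dir x u = v"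
    proof (rule dir_unique[OF x0'])
      show "\<phi> (x + 1 *s ray u) = \<phi> x + (l3 - l2) *s ray v"
        unfolding l2 l3 by (simp add: vector_sub_rdistrib)
    qed (use xu[of 1] x0 in auto)
    then obtain t where t: "\<phi> (x + t *s ray u) = \<phi> x + (l1 - l2) *s ray v"
      using full_line_onto[OF x0' ux] by metis
    let ?x = "x + t *s ray u"
    have P: "\<phi> ?x = \<phi> x1" unfolding t l1 l2 by (simp add: vector_sub_rdistrib)
    have "msq (?x - y) \<noteq> 0"
    proof
      assume 0: "msq (?x - y) = 0"
      have e: "x + (t + 1) *s ray u = ?x + 1 *s ray u" by (simp add: vec.scale_left_distrib)
      have "?x + 1 *s ray u - y = (?x - y) + 1 *s ray u" by simp
      then have "msq (?x + 1 *s ray u - y) = 0"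
        using 0 u ux by (simp only: msq_shift) (simp add: mink_linear perp_def)
      moreover have "msq (?x + 1 *s ray u) = msq x0" using xu e by metis
      ultimately have "\<phi> (?x + 1 *s ray u) = \<phi> ?x" using mono xu 0 by blast
      then show False using adjacent_shift(2)[of ?x 1 u] xu[of t] x0 \<open>msq (?x + 1 *s ray u) = msq x0\<close> by simp
    qed
    then obtain m where "y = m *s ?x" using par[OF xu P] by blast
    moreover have "k \<noteq> 0" unfolding k_def using wu z by (simp add: perp_def)
    ultimately show ?thesis using xu unfolding x_def by blast
  qed
  obtain w1 where w1: "w1 \<in> perp z" using obtain_perp_avoiding[OF z0, of "{}"] by auto
  obtain w2 where w2: "w2 \<in> perp z" "w2 \<noteq> w1" using obtain_perp_avoiding[OF z0, of "{w1}"] by auto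
  obtain w3 where w3: "w3 \<in> perp z" "w3 \<noteq> w1" "w3 \<noteq> w2"
    using obtain_perp_avoiding[OF z0, of "{w1, w2}"] w2 by auto
  have sq: "m * m * msq x0 = msq y" if "y = m *s x" "msq x = msq x0" for m x
    using that by (simp add: mink_linear mult.assoc)
  \<comment> \<open>Equal factors give equal points, so multiples of two different rays would differ
    by a multiple of \<open>ray u\<close>, which is null.\<close>
  have key: False if "w \<noteq> w'" "k \<noteq> 0" "k' \<noteq> 0"
    and e: "y = m *s (z + k *s ray w + t *s ray u)" "y = m *s (z + k' *s ray w' + t' *s ray u)"
    for w w' k k' m t t'
  proof -
    have "m \<noteq> 0" using e(1) y by (auto simp: mink_linear)
    then have "z + k *s ray w + t *s ray u = z + k' *s ray w' + t' *s ray u"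
      using e by (metis vector_mul_lcancel)
    then have "k *s ray w - k' *s ray w' = (t' - t) *s ray u"
      by (simp add: vector_sub_rdistrib algebra_simps)
    then have "msq (k *s ray w - k' *s ray w') = 0" by (simp add: mink_linear)
    then show False using that by (simp add: msq_ray_diff)
  qed
  obtain m1 k1 t1 where 1: "k1 \<noteq> 0" "y = m1 *s (z + k1 *s ray w1 + t1 *s ray u)"
    "msq (z + k1 *s ray w1 + t1 *s ray u) = msq x0" using rep[OF w1] by blast
  obtain m2 k2 t2 where 2: "k2 \<noteq> 0" "y = m2 *s (z + k2 *s ray w2 + t2 *s ray u)"
    "msq (z + k2 *s ray w2 + t2 *s ray u) = msq x0" using rep[OF w2(1)] by blast
  obtain m3 k3 t3 where 3: "k3 \<noteq> 0" "y = m3 *s (z + k3 *s ray w3 + t3 *s ray u)"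
    "msq (z + k3 *s ray w3 + t3 *s ray u) = msq x0" using rep[OF w3(1)] by blast
  have "m1 * m1 = m2 * m2" "m1 * m1 = m3 * m3"
    using sq[OF 1(2,3)] sq[OF 2(2,3)] sq[OF 3(2,3)] x0 by (metis mult_right_cancel)+
  then have "m1 = m2 \<or> m1 = m3 \<or> m2 = m3" using square_eq_imp by (metis minus_minus)
  then show False
    using key[of w1 w2 k1 k2 m1 t1 t2] key[of w1 w3 k1 k3 m1 t1 t3] key[of w2 w3 k2 k3 m2 t2 t3]
      1 2 3 w2 w3 by metis
qed

section \<open>There is no colouring\<close>

text \<open>Together with the origin, a colour class would be a set of \<open>q\<^sup>3 - q\<^sup>2 + q\<close> points, no two of
  them on a null line, that meets every null line contained in a tangent hyperplane through one of
  its points. So each hyperplane parallel to a tangent one contains none or \<open>q\<^sup>2\<close> of its points.\<close>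

lemma no_colouring:
  assumes col: "\<And>y. msq y \<noteq> 0 \<Longrightarrow> \<exists>l. \<phi> y = p + l *s ray v"
  shows False
proof -
  let ?q = "CARD('a)"
  define x0 :: "'a ^ 4" where "x0 = vec4 0 0 0 1"
  have x0: "msq x0 \<noteq> 0" unfolding x0_def mink_def by simp
  define X where "X = {x. msq x \<noteq> 0 \<and> \<phi> x = \<phi> x0}"
  \<comment> \<open>The origin stands in for the cone: the null vectors orthogonal to
    \<open>ray u\<close> are the multiples of \<open>ray u\<close>, which form a line through
    0.\<close>
  define W where "W = insert 0 X"
  have "0 \<notin> X" unfolding X_def by (simp add: mink_linear)
  have cardW: "card W = card X + 1" unfolding W_def using \<open>0 \<notin> X\<close> by simp
  have indep: "msq (w - w') \<noteq> 0" if "w \<in> W" "w' \<in> W" "w \<noteq> w'" for w w'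
    using that adjacent[of w w'] unfolding W_def X_def by (auto simp: mink_linear)
  define H where "H w0 u = {w \<in> W. mink (w - w0) (ray u) = 0}" for w0 u
  have plane: "card {z. mink (z - w0) (ray u) = 0} = ?q ^ 3" for w0 :: "'a ^ 4" and u
    using card_hyperplane[OF ray_ne_0, of u "mink w0 (ray u)"] by (simp add: mink_linear)
  define sh where "sh u = (\<lambda>(w, k). w + k *s ray u)" for u :: "('a \<times> 'a) option"
  have inj: "inj_on (sh u) (H w0 u \<times> UNIV)" for w0 u
  proof (rule inj_onI)
    fix a b assume ab: "a \<in> H w0 u \<times> UNIV" "b \<in> H w0 u \<times> UNIV" "sh u a = sh u b"
    obtain w k w' k' where [simp]: "a = (w, k)" "b = (w', k')" by fastforce
    have eq: "w - w' = (k' - k) *s ray u"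
      using ab(3) unfolding sh_def by (simp add: vector_sub_rdistrib algebra_simps)
    then have "msq (w - w') = 0" by (simp add: mink_linear)
    then have "w = w'" using indep ab unfolding H_def by auto
    then show "a = b" using eq by (simp add: ray_ne_0)
  qed
  have sub: "sh u ` (H w0 u \<times> UNIV) \<subseteq> {z. mink (z - w0) (ray u) = 0}" for w0 u
    unfolding sh_def H_def by (auto simp: mink_linear)
  have cardsh: "card (sh u ` (H w0 u \<times> UNIV)) = card (H w0 u) * ?q" for w0 u
    using card_image[OF inj] by (simp add: card_cartesian_product)
  have le: "card (H w0 u) \<le> ?q ^ 2" for w0 u
  proof -
    have "card (sh u ` (H w0 u \<times> UNIV)) \<le> ?q ^ 3"
      unfolding plane[of w0 u, symmetric] by (rule card_mono[OF _ sub]) simp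
    then have "card (H w0 u) * ?q \<le> ?q ^ 2 * ?q"
      unfolding cardsh by (simp add: power2_eq_square power3_eq_cube)
    then show ?thesis using card_ge by simp
  qed
  \<comment> \<open>A nonnull point of this hyperplane lies on a complete line in direction
    \<open>u\<close>, which takes every colour; a null point is reached from 0. So the bound
    \<open>le\<close> is attained at 0.\<close>
  have onto: "{z. mink (z - 0) (ray u) = 0} \<subseteq> sh u ` (H 0 u \<times> UNIV)" for u
  proof
    fix z assume "z \<in> {z. mink (z - 0) (ray u) = 0}"
    then have z: "mink z (ray u) = 0" by simp
    have "\<exists>w k. w \<in> W \<and> z = w + k *s ray u"
    proof (cases "msq z = 0")
      case True
      then obtain k u' where k: "z = k *s ray u'" by (rule null_is_scaled_ray)
      then have "k = 0 \<or> u' = u" using z by (simp add: mink_linear mink_ray_ray)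
      then have "z = 0 + k *s ray u" using k by auto
      then show ?thesis unfolding W_def by blast
    next
      case False
      have u: "u \<in> perp z" using z unfolding perp_def by simp
      have nn: "msq (z + k *s ray u) \<noteq> 0" for k using msq_shift_perp[OF u] False by simp
      obtain l0 l1 l2 where l: "\<phi> x0 = p + l0 *s ray v" "\<phi> z = p + l1 *s ray v"
        "\<phi> (z + 1 *s ray u) = p + l2 *s ray v" using col False x0 nn by meson
      have "dir z u = v"
      proof (rule dir_unique[OF False nn])
        show "\<phi> (z + 1 *s ray u) = \<phi> z + (l2 - l1) *s ray v"
          unfolding l by (simp add: vector_sub_rdistrib)
      qed simp
      then obtain t where "\<phi> (z + t *s ray u) = \<phi> z + (l0 - l1) *s ray v"
        using full_line_onto[OF False u] by metis
      then have "\<phi> (z + t *s ray u) = \<phi> x0" unfolding l by (simp add: vector_sub_rdistrib)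
      then have "z + t *s ray u \<in> W" unfolding W_def X_def using nn by simp
      moreover have "z = (z + t *s ray u) + (- t) *s ray u" by (simp add: vector_sneg_minus1[symmetric])
      ultimately show ?thesis by blast
    qed
    then obtain w k where w: "w \<in> W" "z = w + k *s ray u" by blast
    then have "w \<in> H 0 u" unfolding H_def using z by (simp add: mink_linear)
    then show "z \<in> sh u ` (H 0 u \<times> UNIV)" unfolding sh_def using w by force
  qed
  have H0: "card (H 0 u) = ?q ^ 2" for u
  proof -
    have "sh u ` (H 0 u \<times> UNIV) = {z. mink (z - 0) (ray u) = 0}" using onto sub by blast
    then have "card (H 0 u) * ?q = ?q ^ 2 * ?q"
      using cardsh[of u 0] plane[of 0 u] by (simp add: power2_eq_square power3_eq_cube)
    then show ?thesis using card_ge by simp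
  qed
  \<comment> \<open>Double count of the pairs (u, w) with \<open>w - w0\<close> orthogonal to
    \<open>ray u\<close>: each difference is nonnull and so orthogonal to exactly q + 1
    directions.\<close>
  have count: "(\<Sum>u\<in>UNIV. card (H w0 u - {w0})) = card X * (?q + 1)" if "w0 \<in> W" for w0
  proof -
    have "(\<Sum>u\<in>UNIV. card (H w0 u - {w0})) = (\<Sum>u\<in>UNIV. \<Sum>w\<in>W - {w0}. if u \<in> perp (w - w0) then 1 else 0)"
    proof (rule sum.cong[OF refl])
      fix u
      have "H w0 u - {w0} = {w \<in> W - {w0}. u \<in> perp (w - w0)}" unfolding H_def perp_def by auto
      then show "card (H w0 u - {w0}) = (\<Sum>w\<in>W - {w0}. if u \<in> perp (w - w0) then 1 else 0)"
        by (simp add: sum.inter_filter[symmetric])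
    qed
    also have "\<dots> = (\<Sum>w\<in>W - {w0}. \<Sum>u\<in>UNIV. if u \<in> perp (w - w0) then 1 else 0)"
      by (rule sum.swap)
    also have "\<dots> = (\<Sum>w\<in>W - {w0}. ?q + 1)"
    proof (rule sum.cong[OF refl])
      fix w assume "w \<in> W - {w0}"
      then have "card (perp (w - w0)) = ?q + 1" using card_perp indep that by blast
      then show "(\<Sum>u\<in>UNIV. if u \<in> perp (w - w0) then 1 else 0) = ?q + 1"
        by (simp add: sum.inter_filter[symmetric])
    qed
    also have "\<dots> = card X * (?q + 1)" using that cardW by simp
    finally show ?thesis .
  qed
  have mem: "w0 \<in> H w0 u" if "w0 \<in> W" for w0 u using that unfolding H_def by (simp add: mink_linear)
  have total: "card X * (?q + 1) = (?q ^ 2 + 1) * (?q ^ 2 - 1)"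
  proof -
    have "0 \<in> W" unfolding W_def by simp
    then have "card (H 0 u - {0}) = ?q ^ 2 - 1" for u using H0[of u] mem[of 0 u] by simp
    then show ?thesis using count[OF \<open>0 \<in> W\<close>] card_directions by (simp add: power2_eq_square)
  qed
  \<comment> \<open>The total is the same for every \<open>w0\<close>, and at 0 every term equals
    the upper bound; hence no term can be smaller elsewhere.\<close>
  have full: "card (H w0 u) = ?q ^ 2" if w0: "w0 \<in> W" for w0 u
  proof (rule ccontr)
    assume "card (H w0 u) \<noteq> ?q ^ 2"
    then have "card (H w0 u - {w0}) < ?q ^ 2 - 1"
      using le[of w0 u] mem[OF w0, of u] card_gt_0_iff[of "H w0 u"] by auto
    moreover have "card (H w0 u' - {w0}) \<le> ?q ^ 2 - 1" for u'
      using le[of w0 u'] mem[OF w0, of u'] by simp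
    ultimately have "(\<Sum>u\<in>UNIV. card (H w0 u - {w0})) < (\<Sum>u\<in>(UNIV :: ('a \<times> 'a) option set). ?q ^ 2 - 1)"
      by (intro sum_strict_mono_ex1) auto
    then show False using count[OF w0] total card_directions by (simp add: power2_eq_square)
  qed
  have "?q ^ 2 dvd card W"
  proof -
    have "card W = card (\<Union>c\<in>UNIV. {w \<in> W. mink w (ray None) = c})"
      by (rule arg_cong[where f = card]) auto
    also have "\<dots> = (\<Sum>c\<in>UNIV. card {w \<in> W. mink w (ray None) = c})"
      by (rule card_UN_disjoint) auto
    finally have "card W = (\<Sum>c\<in>UNIV. card {w \<in> W. mink w (ray None) = c})" .
    moreover have "?q ^ 2 dvd card {w \<in> W. mink w (ray None) = c}" for c
    proof (cases "{w \<in> W. mink w (ray None) = c} = {}")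
      case False
      then obtain w0 where w0: "w0 \<in> W" "mink w0 (ray None) = c" by blast
      then have "{w \<in> W. mink w (ray None) = c} = H w0 None" unfolding H_def by (auto simp: mink_linear)
      then show ?thesis using full[OF w0(1)] by simp
    qed (simp only: card.empty dvd_0_right)
    ultimately show ?thesis by (simp add: dvd_sum)
  qed
  \<comment> \<open>The total yields q^2 (q - 1) + q points in \<open>W\<close>, which is not
    divisible by q^2.\<close>
  define n where "n = ?q - 1"
  have n: "?q = n + 1" using card_ge unfolding n_def by simp
  have "(?q ^ 2 + 1) * (?q ^ 2 - 1) = (?q ^ 2 + 1) * n * (?q + 1)"
    unfolding n by (simp add: power2_eq_square algebra_simps)
  with total have "card X * (?q + 1) = (?q ^ 2 + 1) * n * (?q + 1)" by metis
  then have "card X = (?q ^ 2 + 1) * n" by (simp only: mult_cancel2) simp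
  then have "card W = ?q ^ 2 * n + ?q" using cardW n by simp
  then have "?q ^ 2 dvd ?q" using \<open>?q ^ 2 dvd card W\<close> by (metis dvd_add_right_iff dvd_triv_left)
  then have "?q ^ 2 \<le> ?q" by (rule dvd_imp_le) (use card_ge in simp)
  then show False using card_ge by (simp add: power2_eq_square)
qed

end

context minkowski_field
begin

text \<open>Two linear conditions on four coordinates have a nonzero solution. It cannot be null,
  since a null vector orthogonal to two different rays would be a multiple of both.\<close>

lemma obtain_common_perp:
  fixes u1 u2 :: "('a \<times> 'a) option"
  obtains x where "msq x \<noteq> 0" "u1 \<in> perp x" "u2 \<in> perp x"
proof -
  have ne: "\<exists>x. msq x \<noteq> 0 \<and> u \<in> perp x \<and> w \<in> perp x" if "u \<noteq> w" for u w :: "('a \<times> 'a) option"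
  proof -
    define h where "h z = (mink z (ray u), mink z (ray w))" for z
    have "\<not> inj h"
    proof
      assume "inj h"
      then have "CARD('a ^ 4) \<le> CARD('a \<times> 'a)" by (rule card_inj_on_le) auto
      then have "CARD('a) ^ 4 \<le> CARD('a) ^ 2" by (simp add: card_prod power2_eq_square)
      then show False using card_ge power_le_imp_le_exp[of "CARD('a)" 4 2] by simp
    qed
    then obtain z1 z2 where z: "h z1 = h z2" "z1 \<noteq> z2" by (auto simp: inj_def)
    define x where "x = z1 - z2"
    have x: "x \<noteq> 0" "mink x (ray u) = 0" "mink x (ray w) = 0"
      unfolding x_def using z by (auto simp: h_def mink_linear)
    have "msq x \<noteq> 0"
    proof
      assume "msq x = 0"
      then obtain k t where k: "x = k *s ray t" by (rule null_is_scaled_ray)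
      then have "k \<noteq> 0" using x by auto
      then have "t = u" "t = w" using x k by (auto simp: mink_linear mink_ray_ray)
      then show False using that by simp
    qed
    then show ?thesis using x by (auto simp: perp_def)
  qed
  obtain u3 where "u3 \<noteq> u1" by (cases u1) auto
  then show ?thesis using ne[of u1 u2] ne[of u1 u3] that by (cases "u1 = u2") auto
qed

end

context light_speed_map
begin

section \<open>Injectivity\<close>

lemma dir_inj:
  assumes "msq x \<noteq> 0" "u1 \<in> perp x" "u2 \<in> perp x" "dir x u1 = dir x u2"
  shows "u1 = u2"
proof (rule ccontr)
  assume "u1 \<noteq> u2"
  then have "\<exists>l. \<phi> z = \<phi> x + l *s ray (dir x u1)" if "msq z = msq x" for z
    using collapse_sphere assms that by blast
  then have "\<exists>l. \<phi> y = \<phi> x + l *s ray (dir x u1)" if "msq y \<noteq> 0" for y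
    using collapse_all[OF assms(1)] that by blast
  then show False by (rule no_colouring)
qed

lemma dir_image_perp:
  assumes "msq x \<noteq> 0"
  shows "dir x ` perp x = perp (\<phi> x)"
proof (rule card_subset_eq)
  show "dir x ` perp x \<subseteq> perp (\<phi> x)" using dir_perp[OF assms] by blast
  have "inj_on (dir x) (perp x)" using dir_inj[OF assms] by (auto intro: inj_onI)
  then show "card (dir x ` perp x) = card (perp (\<phi> x))"
    using card_perp[OF assms] card_perp[OF nonnull[OF assms]] by (simp add: card_image)
qed simp

lemma lift_shift:
  assumes "msq x \<noteq> 0" "v \<in> perp (\<phi> x)"
  obtains u k where "u \<in> perp x" "\<phi> (x + k *s ray u) = \<phi> x + l *s ray v"
proof -
  obtain u where "u \<in> perp x" "v = dir x u" using dir_image_perp[OF assms(1)] assms(2) by blast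
  then show ?thesis using full_line_onto[OF assms(1), of u l] that by blast
qed

text \<open>Different tangent lines at \<open>z\<close> have different image lines by
  \<open>dir_inj\<close>, and these meet only in \<open>\<phi> z\<close>.\<close>

lemma fork_inj:
  assumes z: "msq z \<noteq> 0" "u \<in> perp z" "v \<in> perp z" and eq: "\<phi> (z + k *s ray u) = \<phi> (z + l *s ray v)"
  shows "z + k *s ray u = z + l *s ray v"
proof (cases "u = v")
  case True
  then show ?thesis using shift_inj[OF z(1), of k u l] eq z msq_shift_perp by metis
next
  case False
  have nn: "msq (z + k *s ray u) \<noteq> 0" "msq (z + l *s ray v) \<noteq> 0"
    using msq_shift_perp z by metis+
  obtain k' where k': "\<phi> (z + k *s ray u) = \<phi> z + k' *s ray (dir z u)" "k' = 0 \<longleftrightarrow> k = 0"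
    using dir[OF z(1) nn(1)] by metis
  obtain l' where l': "\<phi> (z + l *s ray v) = \<phi> z + l' *s ray (dir z v)" "l' = 0 \<longleftrightarrow> l = 0"
    using dir[OF z(1) nn(2)] by metis
  have "k' *s ray (dir z u) = l' *s ray (dir z v)" using eq k' l' by simp
  moreover have "dir z u \<noteq> dir z v" using dir_inj z False by blast
  ultimately have "k' = 0 \<and> l' = 0" using scaled_ray_eq by blast
  then show ?thesis using k' l' by simp
qed

lemma sphere_surj:
  assumes x: "msq x \<noteq> 0" and z: "msq z = msq (\<phi> x)"
  shows "\<exists>y. msq y = msq x \<and> \<phi> y = z"
proof (rule sphere_induct[of "\<phi> x"])
  fix w v l
  assume w: "\<exists>y. msq y = msq x \<and> \<phi> y = w" and v: "v \<in> perp w"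
  then obtain y where y: "msq y = msq x" "\<phi> y = w" by blast
  then obtain u k where "u \<in> perp y" "\<phi> (y + k *s ray u) = w + l *s ray v"
    using lift_shift[of y v l] x v by metis
  then show "\<exists>y. msq y = msq x \<and> \<phi> y = w + l *s ray v"
    using msq_shift_perp y by metis
qed (use nonnull x z in auto)

text \<open>Antipodes are the only points of a sphere at distance more than two from each other.\<close>

lemma image_uminus:
  assumes x: "msq x \<noteq> 0"
  shows "\<phi> (- x) = - \<phi> x"
proof -
  obtain y where y: "msq y = msq x" "\<phi> y = - \<phi> x"
    using sphere_surj[OF x, of "- \<phi> x"] by (auto simp: mink_linear)
  have c: "msq (\<phi> x) \<noteq> 0" using nonnull[OF x] .
  have "y = - x"
  proof (rule ccontr)
    assume "y \<noteq> - x"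
    have "y \<noteq> x"
    proof
      assume "y = x"
      then have "\<phi> x = - \<phi> x" using y by simp
      then have "msq (\<phi> x) = mink (\<phi> x) (- \<phi> x)" by (rule arg_cong)
      then have "msq (\<phi> x) = - msq (\<phi> x)" by (simp only: mink_linear)
      then show False using c minus_self_iff by metis
    qed
    then obtain u k v l where p: "u \<in> perp x" "v \<in> perp (x + k *s ray u)" "y = x + k *s ray u + l *s ray v"
      using two_step_path[OF x y(1)] \<open>y \<noteq> - x\<close> by metis
    \<comment> \<open>On the sphere with value c, the image of \<open>?m\<close> is adjacent to both
      \<open>\<phi> x\<close> and its negative. Its product with \<open>\<phi> x\<close> is then
      both c and -c, so 4c = 0.\<close>
    let ?m = "x + k *s ray u"
    have m: "msq ?m = msq x" using msq_shift_perp[OF p(1)] .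
    have m': "msq (\<phi> ?m) = msq (\<phi> x)" using msq_image_shift[OF x p(1)] .
    obtain a where a: "\<phi> ?m = \<phi> x + a *s ray (dir x u)" using dir[OF x, of k u] m x by metis
    obtain b where b: "\<phi> y = \<phi> ?m + b *s ray (dir ?m v)"
      using dir[of ?m l v] m x p y(1) by metis
    have "msq (\<phi> ?m - \<phi> x) = 0" unfolding a by (simp add: mink_linear)
    then have 1: "2 * msq (\<phi> x) = 2 * mink (\<phi> ?m) (\<phi> x)" using m' by (simp only: msq_diff) simp
    have "msq (\<phi> y - \<phi> ?m) = 0" unfolding b by (simp add: mink_linear)
    then have "msq (- \<phi> x - \<phi> ?m) = 0" unfolding y(2) .
    moreover have "msq (- \<phi> x - \<phi> ?m) = msq (\<phi> x) + msq (\<phi> ?m) + 2 * mink (\<phi> ?m) (\<phi> x)"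
      by (simp add: mink_linear mink_commute[of "\<phi> x" "\<phi> ?m"])
    ultimately have "msq (\<phi> x) + msq (\<phi> x) + 2 * msq (\<phi> x) = 0" unfolding 1 m' by simp
    moreover have "4 * c = c + c + 2 * c" for c :: 'a by simp
    ultimately have "4 * msq (\<phi> x) = 0" by metis
    then show False using c four_ne_0 by (metis mult_eq_0_iff)
  qed
  then show ?thesis using y by simp
qed

lemma sphere_inj:
  assumes x: "msq x \<noteq> 0" and y: "msq y = msq x" and eq: "\<phi> x = \<phi> y"
  shows "x = y"
proof (rule ccontr)
  assume "x \<noteq> y"
  show False
  proof (cases "y = - x")
    case True
    then have "\<phi> x = - \<phi> x" using eq image_uminus[OF x] by simp
    then have "msq (\<phi> x) = mink (\<phi> x) (- \<phi> x)" by (rule arg_cong)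
    then have "msq (\<phi> x) = - msq (\<phi> x)" by (simp only: mink_linear)
    then show False using nonnull[OF x] minus_self_iff by metis
  next
    case False
    then obtain u k v l where p: "u \<in> perp x" "v \<in> perp (x + k *s ray u)" "y = x + k *s ray u + l *s ray v"
      using two_step_path[OF x y] \<open>x \<noteq> y\<close> by metis
    let ?m = "x + k *s ray u"
    have m: "msq ?m \<noteq> 0" "u \<in> perp ?m" using msq_shift_perp[OF p(1)] x p(1) perp_shift by auto
    have xm: "x = ?m + (- k) *s ray u" by (simp add: vector_sneg_minus1[symmetric])
    have "\<phi> (?m + (- k) *s ray u) = \<phi> (?m + l *s ray v)" using eq p(3) xm by metis
    then have "?m + (- k) *s ray u = ?m + l *s ray v" by (rule fork_inj[OF m p(2)])
    then show False using \<open>x \<noteq> y\<close> p(3) xm by metis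
  qed
qed

text \<open>Two spheres cannot have the same image: a point of one of them has \<open>q\<^sup>2 - q\<close> pairwise
  non-adjacent neighbours in the other, but the image of that point only lies on \<open>q + 1\<close> null lines
  within its sphere.\<close>

lemma spheres_disjoint:
  assumes x: "msq x \<noteq> 0" and y: "msq y \<noteq> 0" and eq: "msq (\<phi> x) = msq (\<phi> y)"
  shows "msq x = msq y"
proof (rule ccontr)
  assume ne: "msq x \<noteq> msq y"
  \<comment> \<open>The parameter at which the null line through \<open>y\<close> in direction
    \<open>e\<close> meets the sphere of \<open>x\<close>.\<close>
  define k where "k e = (msq x - msq y) / (2 * mink y (ray e))" for e
  have k: "k e \<noteq> 0" "msq (y + k e *s ray e) = msq x" if "e \<notin> perp y" for e
  proof -
    have m: "2 * mink y (ray e) \<noteq> 0" using that two_ne_0 by (simp add: perp_def)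
    then show "k e \<noteq> 0" unfolding k_def using ne by simp
    have "k e * (2 * mink y (ray e)) = msq x - msq y"
      unfolding k_def using m by (metis nonzero_divide_eq_eq)
    then show "msq (y + k e *s ray e) = msq x"
      by (simp add: msq_shift mult.assoc mult.left_commute)
  qed
  have rep: "\<exists>l. \<phi> (y + k e *s ray e) = \<phi> y + l *s ray (dir y e) \<and> l \<noteq> 0" if "e \<notin> perp y" for e
    using dir[OF y, of "k e" e] k[OF that] x by metis
  have same: "msq (\<phi> (y + k e *s ray e)) = msq (\<phi> y)" if "e \<notin> perp y" for e
    using sphere_image[OF x k(2)[OF that]] eq by simp
  have tangent: "dir y e \<in> perp (\<phi> y)" if e: "e \<notin> perp y" for e
  proof -
    obtain l where l: "\<phi> (y + k e *s ray e) = \<phi> y + l *s ray (dir y e)" "l \<noteq> 0"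
      using rep[OF e] by blast
    have "2 * l * mink (\<phi> y) (ray (dir y e)) = 0" using same[OF e] unfolding l(1) msq_shift by simp
    then show ?thesis using l(2) two_ne_0 by (simp add: perp_def)
  qed
  \<comment> \<open>With equal image lines, the image of \<open>?x2\<close> can be reached from that
    of \<open>?x1\<close> by a tangent move, which lifts. Injectivity on the sphere makes
    \<open>?x1\<close> and \<open>?x2\<close> null-separated, which different directions from
    \<open>y\<close> rule out.\<close>
  have "e1 = e2" if e: "e1 \<notin> perp y" "e2 \<notin> perp y" and d: "dir y e1 = dir y e2" for e1 e2
  proof -
    let ?x1 = "y + k e1 *s ray e1" and ?x2 = "y + k e2 *s ray e2" and ?v = "dir y e1"
    obtain l1 l2 where l: "\<phi> ?x1 = \<phi> y + l1 *s ray ?v" "\<phi> ?x2 = \<phi> y + l2 *s ray ?v"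
      using rep[OF e(1)] rep[OF e(2)] d by metis
    have x1: "msq ?x1 \<noteq> 0" using k[OF e(1)] x by simp
    have "?v \<in> perp (\<phi> ?x1)" using tangent[OF e(1)] unfolding l perp_shift .
    then obtain u j where u: "u \<in> perp ?x1" "\<phi> (?x1 + j *s ray u) = \<phi> ?x1 + (l2 - l1) *s ray ?v"
      using lift_shift[OF x1] by metis
    have "\<phi> (?x1 + j *s ray u) = \<phi> ?x2" unfolding u l by (simp add: vector_sub_rdistrib)
    moreover have "msq (?x1 + j *s ray u) = msq x" "msq ?x2 = msq x"
      using msq_shift_perp[OF u(1)] k e by metis+
    ultimately have "?x1 + j *s ray u = ?x2" using sphere_inj x by metis
    then have "k e2 *s ray e2 - k e1 *s ray e1 = j *s ray u" by (simp add: algebra_simps)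
    then have "msq (k e2 *s ray e2 - k e1 *s ray e1) = 0" by (simp add: mink_linear)
    then show ?thesis using k e by (auto simp: msq_ray_diff)
  qed
  then have "inj_on (dir y) (- perp y)" by (auto intro: inj_onI)
  then have "card (- perp y) \<le> card (perp (\<phi> y))"
    by (rule card_inj_on_le) (use tangent in auto)
  moreover have "card (- perp y) = CARD('a) * CARD('a) - CARD('a)"
    using card_perp[OF y] card_directions by (simp add: Compl_eq_Diff_UNIV card_Diff_subset)
  ultimately have "CARD('a) * CARD('a) \<le> 2 * CARD('a) + 1"
    using card_perp[OF nonnull[OF y]] by simp
  moreover have "7 * CARD('a) \<le> CARD('a) * CARD('a)" using card_ge by (rule mult_right_mono) simp
  ultimately show False using card_ge by linarith
qed

lemma nonnull_inj:
  assumes "msq x \<noteq> 0" "msq y \<noteq> 0" "\<phi> x = \<phi> y"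
  shows "x = y"
  using sphere_inj[OF assms(1) _ assms(3)] spheres_disjoint[OF assms(1,2)] assms(3) by simp

text \<open>An injective map of the finite set of adjacent pairs into itself is onto, so an adjacent
  pair of images comes from an adjacent pair.\<close>

lemma adjacent_reflect:
  assumes x: "msq x \<noteq> 0" and y: "msq y \<noteq> 0" and eq: "msq (\<phi> x - \<phi> y) = 0"
  shows "msq (x - y) = 0"
proof (cases "x = y")
  case False
  define E where "E = {(x, y). msq x \<noteq> 0 \<and> msq y \<noteq> 0 \<and> x \<noteq> y \<and> msq (x - y) = 0}"
  define h where "h = (\<lambda>(x, y). (\<phi> x, \<phi> y))"
  have "h ` E \<subseteq> E" unfolding h_def E_def using adjacent nonnull by auto
  moreover have "inj_on h E" unfolding h_def E_def using nonnull_inj by (auto intro!: inj_onI)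
  ultimately have hE: "h ` E = E" by (intro endo_inj_surj) auto
  have "(\<phi> x, \<phi> y) \<in> E" unfolding E_def using nonnull x y eq nonnull_inj False by auto
  then obtain a b where ab: "(a, b) \<in> E" "(\<phi> x, \<phi> y) = h (a, b)"
    using hE by (metis imageE surj_pair)
  then have "x = a" "y = b" using nonnull_inj x y unfolding h_def E_def by auto
  then show ?thesis using ab unfolding E_def by auto
qed (simp add: mink_linear)

section \<open>The action on null directions\<close>

text \<open>If the image of a point \<open>z\<close> orthogonal to \<open>u\<close> were not
  orthogonal to \<open>?v\<close>, the image line through \<open>\<phi> x\<close> would contain a
  neighbour of it. Reflecting adjacency puts \<open>z\<close> on the line through \<open>x\<close>
  in direction \<open>u\<close>, a contradiction. Applied to two points on the line through
  \<open>y\<close>, this makes \<open>dir y u\<close> orthogonal to \<open>?v\<close>, hence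
  equal.\<close>

lemma dir_const:
  assumes x: "msq x \<noteq> 0" "u \<in> perp x" and y: "msq y \<noteq> 0" "u \<in> perp y"
  shows "dir x u = dir y u"
proof -
  let ?v = "dir x u"
  have v: "?v \<in> perp (\<phi> z)" if z: "msq z \<noteq> 0" "u \<in> perp z" for z
  proof (rule ccontr)
    assume nv: "?v \<notin> perp (\<phi> z)"
    have "mink (\<phi> x - \<phi> z) (ray ?v) \<noteq> 0"
      using nv dir_perp[OF x] by (simp add: perp_def mink_linear)
    then obtain l where l: "msq (\<phi> x + l *s ray ?v - \<phi> z) = 0" using null_point_on_line by blast
    obtain j where j: "\<phi> (x + j *s ray u) = \<phi> x + l *s ray ?v" using full_line_onto[OF x] by blast
    have xj: "msq (x + j *s ray u) \<noteq> 0" using msq_shift_perp[OF x(2)] x by simp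
    have "msq (x + j *s ray u - z) = 0" using adjacent_reflect[OF xj z(1)] j l by simp
    then have "msq (z - (x + j *s ray u)) = 0" by (simp only: msq_diff_commute)
    then obtain m w where m: "z = x + j *s ray u + m *s ray w" by (rule null_diff)
    have "m * mink (ray w) (ray u) = 0"
      using z(2) x(2) unfolding m by (simp add: perp_def mink_linear)
    then have "m = 0 \<or> w = u" by (simp add: mink_ray_ray)
    then have "z = x + (j + m) *s ray u" using m by (auto simp: vec.scale_left_distrib)
    moreover obtain n where "\<phi> (x + (j + m) *s ray u) = \<phi> x + n *s ray ?v"
      using dir[OF x(1), of "j + m" u] msq_shift_perp[OF x(2)] x by metis
    ultimately show False using nv dir_perp[OF x] perp_shift by metis
  qed
  have y1: "msq (y + 1 *s ray u) \<noteq> 0" "u \<in> perp (y + 1 *s ray u)"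
    using msq_shift_perp[OF y(2), of 1] y perp_shift[of u y 1] by auto
  obtain l where l: "\<phi> (y + 1 *s ray u) = \<phi> y + l *s ray (dir y u)" "l \<noteq> 0"
    using dir[OF y(1) y1(1)] by (metis one_neq_zero)
  have "l * mink (ray (dir y u)) (ray ?v) = 0"
    using v[OF y] v[OF y1] unfolding l by (simp add: perp_def mink_linear)
  then show ?thesis using l(2) by (simp add: mink_ray_ray)
qed

definition \<delta> :: "('a \<times> 'a) option \<Rightarrow> ('a \<times> 'a) option" where
  "\<delta> u = dir (SOME x. msq x \<noteq> 0 \<and> u \<in> perp x) u"

lemma dir_eq_delta:
  assumes "msq x \<noteq> 0" "u \<in> perp x"
  shows "dir x u = \<delta> u"
proof -
  have "\<exists>x. msq x \<noteq> 0 \<and> u \<in> perp x" using assms by blast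
  from someI_ex[OF this] show ?thesis unfolding \<delta>_def using dir_const assms by blast
qed

lemma delta_inj: "\<delta> u1 = \<delta> u2 \<Longrightarrow> u1 = u2"
  using obtain_common_perp[of u1 u2] dir_inj dir_eq_delta by metis

text \<open>\<open>\<delta>\<close> carries circles to circles: the circle of \<open>x\<close> goes
  onto that of \<open>\<phi> x\<close>.\<close>

lemma delta_perp_iff:
  assumes "msq x \<noteq> 0"
  shows "\<delta> u \<in> perp (\<phi> x) \<longleftrightarrow> u \<in> perp x"
proof -
  have "\<delta> ` perp x = perp (\<phi> x)"
    using dir_image_perp[OF assms] dir_eq_delta[OF assms] by (metis (no_types, lifting) image_cong)
  then show ?thesis using delta_inj by (metis image_iff)
qed

end

section \<open>The affine plane at a null direction\<close>

text \<open>The fundamental theorem of affine geometry for a collineation fixing the standard frame.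
  Parallels to the axes and the diagonal reduce it to one function \<open>g\<close>; the lines y = x
  + b give additivity and the lines y = m x give multiplicativity.\<close>

lemma line_preserving_plane_map:
  fixes f :: "'a::field \<times> 'a \<Rightarrow> 'a \<times> 'a"
  assumes surj: "surj f"
    and lines: "\<And>r s t. r \<noteq> 0 \<or> s \<noteq> 0 \<Longrightarrow> \<exists>A C G. (A \<noteq> 0 \<or> C \<noteq> 0) \<and>
       (\<forall>a b. r * a + s * b = t \<longleftrightarrow> A * fst (f (a, b)) + C * snd (f (a, b)) = G)"
    and fix0: "f (0, 0) = (0, 0)" and fix1: "f (1, 0) = (1, 0)" and fix2: "f (0, 1) = (0, 1)"
  obtains g where "\<And>a b. f (a, b) = (g a, g b)" "\<And>a b. g (a + b) = g a + g b"
    "\<And>a b. g (a * b) = g a * g b" "g 1 = 1"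
proof -
  have x_axis: "snd (f (a, b)) = 0 \<longleftrightarrow> b = 0" for a b
  proof -
    obtain A C G where *: "A \<noteq> 0 \<or> C \<noteq> 0"
      "\<And>a b. 0 * a + 1 * b = 0 \<longleftrightarrow> A * fst (f (a, b)) + C * snd (f (a, b)) = G"
      using lines[of 0 1 0] by auto
    have "G = 0" using *(2)[of 0 0] fix0 by simp
    then have "A = 0" using *(2)[of 1 0] fix1 by simp
    then show ?thesis using * \<open>G = 0\<close> by auto
  qed
  have y_axis: "fst (f (a, b)) = 0 \<longleftrightarrow> a = 0" for a b
  proof -
    obtain A C G where *: "A \<noteq> 0 \<or> C \<noteq> 0"
      "\<And>a b. 1 * a + 0 * b = 0 \<longleftrightarrow> A * fst (f (a, b)) + C * snd (f (a, b)) = G"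
      using lines[of 1 0 0] by auto
    have "G = 0" using *(2)[of 0 0] fix0 by simp
    then have "C = 0" using *(2)[of 0 1] fix2 by simp
    then show ?thesis using * \<open>G = 0\<close> by auto
  qed
  have snd_const: "snd (f (a, b)) = snd (f (0, b))" for a b
  proof (cases "b = 0")
    case False
    obtain A C G where *: "A \<noteq> 0 \<or> C \<noteq> 0"
      "\<And>a c. 0 * a + 1 * c = b \<longleftrightarrow> A * fst (f (a, c)) + C * snd (f (a, c)) = G"
      using lines[of 0 1 b] by auto
    \<comment> \<open>Otherwise the image of this parallel would cross the x-axis, which only points
      of the x-axis reach.\<close>
    have "A = 0"
    proof (rule ccontr)
      assume "A \<noteq> 0"
      obtain p where "f p = (G / A, 0)" using surj by (metis surjD)
      moreover obtain a c where "p = (a, c)" by fastforce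
      ultimately show False using *(2)[of a c] x_axis[of a c] \<open>A \<noteq> 0\<close> False by simp
    qed
    then have "C \<noteq> 0" "C * snd (f (a, b)) = G" "C * snd (f (0, b)) = G"
      using *(1) *(2)[of a b] *(2)[of 0 b] by simp_all
    then show ?thesis by (metis mult_left_cancel)
  qed (use x_axis[of a b] x_axis[of 0 b] in simp)
  have fst_const: "fst (f (a, b)) = fst (f (a, 0))" for a b
  proof (cases "a = 0")
    case False
    obtain A C G where *: "A \<noteq> 0 \<or> C \<noteq> 0"
      "\<And>c b. 1 * c + 0 * b = a \<longleftrightarrow> A * fst (f (c, b)) + C * snd (f (c, b)) = G"
      using lines[of 1 0 a] by auto
    have "C = 0"
    proof (rule ccontr)
      assume "C \<noteq> 0"
      obtain p where "f p = (0, G / C)" using surj by (metis surjD)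
      moreover obtain c b where "p = (c, b)" by fastforce
      ultimately show False using *(2)[of c b] y_axis[of c b] \<open>C \<noteq> 0\<close> False by simp
    qed
    then have "A \<noteq> 0" "A * fst (f (a, b)) = G" "A * fst (f (a, 0)) = G"
      using *(1) *(2)[of a b] *(2)[of a 0] by simp_all
    then show ?thesis by (metis mult_left_cancel)
  qed (use y_axis[of a b] y_axis[of a 0] in simp)
  define g where "g a = fst (f (a, 0))" for a
  define h where "h b = snd (f (0, b))" for b
  have gh: "f (a, b) = (g a, h b)" for a b
    using fst_const[of a b] snd_const[of a b] unfolding g_def h_def by (simp add: prod_eq_iff)
  have vals: "g 0 = 0" "g 1 = 1" "h 0 = 0" "h 1 = 1"
    unfolding g_def h_def by (simp_all add: fix0 fix1 fix2)
  \<comment> \<open>The image of the diagonal contains (0, 0) and (1, 1), so it is the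
    diagonal.\<close>
  have "g a = h a" for a
  proof -
    obtain A C G where *: "A \<noteq> 0 \<or> C \<noteq> 0"
      "\<And>a b. 1 * a + (- 1) * b = 0 \<longleftrightarrow> A * g a + C * h b = G"
      using lines[of 1 "- 1" 0] by (auto simp: gh)
    have "G = 0" using *(2)[of 0 0] by (simp add: vals)
    moreover have "A + C = G" using *(2)[of 1 1] by (simp add: vals)
    ultimately have "A = - C" by (simp add: eq_neg_iff_add_eq_0)
    then show ?thesis using *(1) *(2)[of a a] \<open>G = 0\<close> by auto
  qed
  then have gg: "f (a, b) = (g a, g b)" for a b using gh by simp
  have inj_g: "g a = g b \<longleftrightarrow> a = b" for a b
  proof -
    obtain A C G where *: "A \<noteq> 0 \<or> C \<noteq> 0"
      "\<And>a b. 1 * a + (- 1) * b = 0 \<longleftrightarrow> A * g a + C * g b = G"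
      using lines[of 1 "- 1" 0] by (auto simp: gg)
    have "G = 0" using *(2)[of 0 0] by (simp add: vals)
    moreover have "A + C = G" using *(2)[of 1 1] by (simp add: vals)
    ultimately have "A = - C" by (simp add: eq_neg_iff_add_eq_0)
    then show ?thesis using * *(2)[of a b] \<open>G = 0\<close> by auto
  qed
  have add: "g (a + b) = g a + g b" for a b
  proof (cases "b = 0")
    case False
    obtain A C G where *: "A \<noteq> 0 \<or> C \<noteq> 0"
      "\<And>x y. (- 1) * x + 1 * y = b \<longleftrightarrow> A * g x + C * g y = G"
      using lines[of "- 1" 1 b] by (auto simp: gg)
    \<comment> \<open>Otherwise the image of y = x + b would meet the diagonal, whose preimage is
      the parallel line y = x.\<close>
    have "A + C = 0"
    proof (rule ccontr)
      assume AC: "A + C \<noteq> 0"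
      obtain p where "f p = (G / (A + C), G / (A + C))" using surj by (metis surjD)
      moreover obtain x y where "p = (x, y)" by fastforce
      ultimately have p: "g x = G / (A + C)" "g y = G / (A + C)" by (auto simp: gg)
      then have "x = y" using inj_g by metis
      moreover have "A * g x + C * g y = G" unfolding p using AC by (simp add: ring_distribs[symmetric] add_divide_distrib[symmetric])
      ultimately show False using *(2)[of x y] False by simp
    qed
    then have A: "A = - C" by (simp add: eq_neg_iff_add_eq_0)
    have "C * g b = G" using *(2)[of 0 b] by (simp add: vals)
    moreover have "C * (g (a + b) - g a) = G" using *(2)[of a "a + b"] A by (simp add: algebra_simps)
    ultimately have "C * g b = C * (g (a + b) - g a)" by simp
    then show ?thesis using * A by simp
  qed (simp add: vals)
  have mult: "g (m * a) = g m * g a" for m a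
  proof -
    obtain A C G where *: "A \<noteq> 0 \<or> C \<noteq> 0"
      "\<And>x y. m * x + (- 1) * y = 0 \<longleftrightarrow> A * g x + C * g y = G"
      using lines[of m "- 1" 0] by (auto simp: gg)
    have G: "G = 0" using *(2)[of 0 0] by (simp add: vals)
    have "A + C * g m = 0" using *(2)[of 1 m] G by (simp add: vals)
    then have A: "A = - (C * g m)" by (simp add: eq_neg_iff_add_eq_0)
    have "A * g a + C * g (m * a) = 0" using *(2)[of a "m * a"] G by simp
    then have "C * (g (m * a) - g m * g a) = 0" unfolding A by (simp add: algebra_simps)
    then show ?thesis using * A by auto
  qed
  show ?thesis by (rule that[OF gg add mult vals(2)])
qed

context light_speed_map
begin

text \<open>The images of \<open>None\<close> and (0, 0) span a hyperbolic plane; its orthogonal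
  complement serves as the affine plane in which the other image directions have coordinates.
  Circles through \<open>None\<close> make the coordinate change semilinear, and circles about the
  origin make it a similitude.\<close>

lemma semilinear_model:
  obtains g M s where "field_automorphism g" "s \<noteq> 0"
    "\<And>v w. mink (M *v v) (M *v w) = s * mink v w"
    "\<And>t. \<exists>k. k \<noteq> 0 \<and> M *v vmap g (ray t) = k *s ray (\<delta> t)"
proof -
  define P where "P = ray (\<delta> None)"
  \<comment> \<open>Rescales the image rays so that each has product 2 with \<open>P\<close>, as
    every finite \<open>ray\<close> has with \<open>ray None\<close>.\<close>
  define c where "c w = 2 / mink (ray (\<delta> (Some w))) P" for w
  define R where "R w = c w *s ray (\<delta> (Some w))" for w
  define E where "E = R (0, 0)"
  \<comment> \<open>The component orthogonal to \<open>P\<close> and \<open>E\<close>. Nullity of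
    \<open>R w\<close> determines the coefficient of \<open>P\<close> from it, so \<open>f'\<close>
    carries all information.\<close>
  define f' where "f' w = R w - E - (mink (R w) E / 2) *s P" for w
  have nz: "mink (ray (\<delta> (Some w))) P \<noteq> 0" for w
    unfolding P_def mink_ray_ray using delta_inj by blast
  have c: "c w \<noteq> 0" for w unfolding c_def using nz two_ne_0 by simp
  have RP: "mink (R w) P = 2" for w
    unfolding R_def c_def using nz by (simp add: mink_linear)
  have R0: "msq (R w) = 0" for w unfolding R_def by (simp add: mink_linear)
  have P0: "msq P = 0" unfolding P_def by simp
  have EP: "mink E P = 2" "mink P E = 2" "msq E = 0"
    unfolding E_def using RP R0 mink_commute by metis+
  have f'P: "mink (f' w) P = 0" "mink (f' w) E = 0" "mink P (f' w) = 0" "mink E (f' w) = 0" for w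
  proof -
    show "mink (f' w) P = 0" "mink (f' w) E = 0"
      unfolding f'_def using EP RP P0 two_ne_0 by (simp_all add: mink_linear)
    then show "mink P (f' w) = 0" "mink E (f' w) = 0" using mink_commute by metis+
  qed
  have R: "R w = E + f' w - (msq (f' w) / 4) *s P" for w
  proof -
    have e: "R w = E + f' w + (mink (R w) E / 2) *s P" unfolding f'_def by simp
    have "msq (E + f' w + l *s P) = msq (f' w) + 4 * l" for l
      using f'P EP P0 by (simp add: mink_linear)
    then have "msq (f' w) + 4 * (mink (R w) E / 2) = 0" using R0[of w] e by metis
    then have "mink (R w) E / 2 = - (msq (f' w)) / 4"
      using four_ne_0 by (intro solve_linear) (simp_all add: mult.commute)
    then have "R w = E + f' w + (- (msq (f' w) / 4)) *s P" using e by (metis minus_divide_left)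
    then show ?thesis by (simp only: vec.scale_minus_left diff_conv_add_uminus)
  qed
  have inc: "mink (\<phi> x) (R w) = 0 \<longleftrightarrow> mink x (ray (Some w)) = 0"
    "mink (\<phi> x) P = 0 \<longleftrightarrow> mink x (ray None) = 0" if "msq x \<noteq> 0" for x w
    using delta_perp_iff[OF that] c unfolding R_def P_def by (auto simp: perp_def mink_linear)
  have f'0: "f' (0, 0) = 0" unfolding f'_def E_def[symmetric] by (simp add: EP)

  have line: "\<exists>y. mink y P = 0 \<and> (\<forall>a b. r * a + s * b = t \<longleftrightarrow> mink y E + mink y (f' (a, b)) = 0)"
    if "r \<noteq> 0 \<or> s \<noteq> 0" for r s t
  proof -
    \<comment> \<open>Equal last coordinates put \<open>None\<close> on the circle of
      \<open>x\<close>, whose finite part is the line r a + s b = t.\<close>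
    define x where "x = vec4 r s t t"
    have x: "msq x \<noteq> 0"
    proof
      assume "msq x = 0"
      then have "r * r + s * s = 0" unfolding x_def mink_def
        by (simp add: algebra_simps) (metis add.right_inverse)
      then show False using sum_squares_eq_0 that by blast
    qed
    have "mink (\<phi> x) P = 0" using inc(2)[OF x] by (simp add: x_def mink_ray)
    moreover have "r * a + s * b = t \<longleftrightarrow> mink (\<phi> x) E + mink (\<phi> x) (f' (a, b)) = 0" for a b
    proof -
      have "mink x (ray (Some (a, b))) = 2 * (t - (r * a + s * b))"
        unfolding x_def mink_ray by (simp add: algebra_simps)
      then have "mink x (ray (Some (a, b))) = 0 \<longleftrightarrow> t - (r * a + s * b) = 0"
        using two_ne_0 by (simp only: mult_eq_0_iff) simp
      then have "r * a + s * b = t \<longleftrightarrow> mink x (ray (Some (a, b))) = 0" by auto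
      also have "\<dots> \<longleftrightarrow> mink (\<phi> x) (R (a, b)) = 0" using inc(1)[OF x] by simp
      also have "mink (\<phi> x) (R (a, b)) = mink (\<phi> x) E + mink (\<phi> x) (f' (a, b))"
        unfolding R[of "(a, b)"] using \<open>mink (\<phi> x) P = 0\<close> by (simp add: mink_linear)
      finally show ?thesis .
    qed
    ultimately show ?thesis by blast
  qed
  define u1 u2 where "u1 = f' (1, 0)" and "u2 = f' (0, 1)"
  obtain y1 where y1: "mink y1 P = 0"
    "\<And>a b. 1 * a + 0 * b = 0 \<longleftrightarrow> mink y1 E + mink y1 (f' (a, b)) = 0" using line[of 1 0 0] by auto
  obtain y2 where y2: "mink y2 P = 0"
    "\<And>a b. 0 * a + 1 * b = 0 \<longleftrightarrow> mink y2 E + mink y2 (f' (a, b)) = 0" using line[of 0 1 0] by auto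
  have yE: "mink y1 E = 0" "mink y2 E = 0"
    using y1(2)[of 0 0] y2(2)[of 0 0] by (simp_all add: f'0 mink_linear)
  have yu: "mink y1 u2 = 0" "mink y1 u1 \<noteq> 0" "mink y2 u1 = 0" "mink y2 u2 \<noteq> 0"
    using y1(2)[of 0 1] y1(2)[of 1 0] y2(2)[of 0 1] y2(2)[of 1 0] yE unfolding u1_def u2_def by simp_all
  have uP: "mink u1 P = 0" "mink u1 E = 0" "mink P u1 = 0" "mink E u1 = 0"
    "mink u2 P = 0" "mink u2 E = 0" "mink P u2 = 0" "mink E u2 = 0"
    unfolding u1_def u2_def using f'P by auto
  have indep: "a = 0 \<and> b = 0 \<and> k = 0 \<and> l = 0"
    if eq: "a *s P + b *s E + k *s u1 + l *s u2 = 0" for a b k l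
  proof -
    let ?v = "a *s P + b *s E + k *s u1 + l *s u2"
    have "mink y1 ?v = 0" "mink y2 ?v = 0" "mink P ?v = 0" "mink E ?v = 0"
      unfolding eq by (simp_all add: mink_linear)
    then show ?thesis
      using y1(1) y2(1) yE yu uP EP P0 two_ne_0 by (auto simp: mink_linear)
  qed
  have span: "\<exists>k l. v = k *s u1 + l *s u2" if "mink P v = 0" "mink E v = 0" for v
  proof -
    obtain a b k l where v: "v = a *s P + b *s E + k *s u1 + l *s u2"
      using inj_combination_spans[OF indep] by blast
    have "a = 0" "b = 0" using that uP EP P0 two_ne_0 unfolding v by (auto simp: mink_linear)
    then show ?thesis using v by auto
  qed
  define f where "f w = (mink y1 (f' w) / mink y1 u1, mink y2 (f' w) / mink y2 u2)" for w
  have f: "f' w = fst (f w) *s u1 + snd (f w) *s u2" for w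
  proof -
    obtain k l where "f' w = k *s u1 + l *s u2" using span f'P by blast
    then show ?thesis unfolding f_def using yu by (simp add: mink_linear)
  qed
  have "inj f"
  proof (rule injI)
    fix w w' assume "f w = f w'"
    then have "f' w = f' w'" using f by metis
    then have "R w = R w'" using R by metis
    then show "w = w'" unfolding R_def using scaled_ray_eq c delta_inj by blast
  qed
  then have "surj f" by (simp add: finite_UNIV_inj_surj)
  have lines: "\<exists>A C G. (A \<noteq> 0 \<or> C \<noteq> 0) \<and>
       (\<forall>a b. r * a + s * b = t \<longleftrightarrow> A * fst (f (a, b)) + C * snd (f (a, b)) = G)"
    if rs: "r \<noteq> 0 \<or> s \<noteq> 0" for r s t
  proof -
    obtain y where y: "\<And>a b. r * a + s * b = t \<longleftrightarrow> mink y E + mink y (f' (a, b)) = 0"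
      using line[OF rs] by blast
    have eq: "r * a + s * b = t \<longleftrightarrow> mink y u1 * fst (f (a, b)) + mink y u2 * snd (f (a, b)) = - mink y E" for a b
    proof -
      have "mink y (f' (a, b)) = mink y u1 * fst (f (a, b)) + mink y u2 * snd (f (a, b))"
        unfolding f[of "(a, b)"] by (simp add: mink_linear mult.commute)
      then show ?thesis unfolding y by (metis add.commute eq_neg_iff_add_eq_0)
    qed
    have "mink y u1 \<noteq> 0 \<or> mink y u2 \<noteq> 0"
    proof (rule ccontr)
      assume "\<not> ?thesis"
      then have const: "r * a + s * b = t \<longleftrightarrow> r * a' + s * b' = t" for a b a' b'
        using eq[of a b] eq[of a' b'] by simp
      show False
      proof (cases "r = 0")
        case True
        then show False using const[of 0 "t / s" 0 "(t + 1) / s"] rs by simp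
      next
        case False
        then show False using const[of "t / r" 0 "(t + 1) / r" 0] by simp
      qed
    qed
    then show ?thesis using eq by blast
  qed
  have fixed: "f (0, 0) = (0, 0)" "f (1, 0) = (1, 0)" "f (0, 1) = (0, 1)"
    unfolding f_def f'0 using yu by (simp_all add: mink_linear flip: u1_def u2_def)
  obtain g where g: "\<And>a b. f (a, b) = (g a, g b)" "\<And>a b. g (a + b) = g a + g b"
    "\<And>a b. g (a * b) = g a * g b" "g 1 = 1"
    using line_preserving_plane_map[OF \<open>surj f\<close> lines fixed] by metis
  have g0: "g 0 = 0" using g(2)[of 0 0] by (metis add_0 add_cancel_right_right)
  have gm: "g (- a) = - g a" for a using g(2)[of a "- a"] g0 by (simp add: eq_neg_iff_add_eq_0 add.commute)
  have gd: "g (a - b) = g a - g b" for a b using g(2)[of a "- b"] gm by simp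
  have g2: "g 2 = 2" using g(2)[of 1 1] g(4) by simp
  have "inj g"
    by (rule injI) (use \<open>inj f\<close> g(1) in \<open>metis injD prod.inject\<close>)
  then have aut: "field_automorphism g"
    unfolding field_automorphism_def using g by (simp add: bij_def finite_UNIV_inj_surj)
  have f'g: "f' (a, b) = g a *s u1 + g b *s u2" for a b
    using f[of "(a, b)"] g(1) by simp

  have circ: "msq (f' (a, b)) = msq (f' (a', b'))"
    if ab: "a * a + b * b = r" "a' * a' + b' * b' = r" and r: "r \<noteq> 0" for a b a' b' r
  proof -
    \<comment> \<open>Chosen so that the circle of \<open>x\<close> is a^2 + b^2 = r.\<close>
    define x where "x = vec4 0 0 (- 1 - r) (1 - r)"
    have "msq x = - 4 * r" unfolding x_def mink_def by (simp add: algebra_simps)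
    then have x: "msq x \<noteq> 0" using r four_ne_0 by simp
    define y where "y = \<phi> x"
    have yP: "mink y P \<noteq> 0" using inc(2)[OF x] two_ne_0 unfolding y_def by (simp add: x_def mink_ray)
    have on: "mink y E + mink y (f' (a, b)) - msq (f' (a, b)) / 4 * mink y P = 0"
      if "a * a + b * b = r" for a b
    proof -
      have "mink x (ray (Some (a, b))) = 0"
        unfolding mink_ray that x_def by (simp add: algebra_simps)
      then have "mink y (R (a, b)) = 0" using inc(1)[OF x] unfolding y_def by simp
      then show ?thesis unfolding R[of "(a, b)"] by (simp add: mink_linear)
    qed
    have val: "msq (f' (a, b)) = 4 * (mink y E / mink y P)" if ab: "a * a + b * b = r" for a b
    proof -
      \<comment> \<open>The circle is symmetric about the origin and \<open>f'\<close> is odd, so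
        comparing opposite points removes the linear term and leaves a norm depending only on
        r.\<close>
      have m: "f' (- a, - b) = - f' (a, b)" unfolding f'g gm by simp
      have 1: "mink y E + mink y (f' (a, b)) - msq (f' (a, b)) / 4 * mink y P = 0" using on ab by blast
      have 2: "mink y E - mink y (f' (a, b)) - msq (f' (a, b)) / 4 * mink y P = 0"
        using on[of "- a" "- b"] ab unfolding m by (simp add: mink_linear)
      have "2 * j = (i + j - k) - (i - j - k)" for i j k :: 'a by simp
      then have "2 * mink y (f' (a, b)) = 0" using 1 2 by (metis diff_self)
      then have "mink y (f' (a, b)) = 0" using two_ne_0 by simp
      then have "mink y E = msq (f' (a, b)) / 4 * mink y P" using 1 by simp
      then show ?thesis using yP four_ne_0 by (simp add: divide_simps mult.commute)
    qed
    show ?thesis using val ab by simp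
  qed
  define U where "U = msq u1"
  have U2: "msq u2 = U"
    using circ[of 1 0 1 0 1] by (simp add: U_def u1_def u2_def)
  have u12: "mink u1 u2 = 0"
  proof -
    have "msq (u1 + u2) = msq (u1 - u2)"
      using circ[of 1 1 2 1 "- 1"] two_ne_0 by (simp add: f'g gm g(4))
    then have "4 * mink u1 u2 = 0"
      by (simp add: mink_linear mink_commute[of u2 u1])
    then show ?thesis using four_ne_0 by simp
  qed
  have u21: "mink u2 u1 = 0" using u12 mink_commute by metis
  \<comment> \<open>A null \<open>u1\<close> orthogonal to \<open>P\<close> would be a multiple of
    \<open>P\<close>, but \<open>y1\<close> is orthogonal to \<open>P\<close> and not to
    \<open>u1\<close>.\<close>
  have "U \<noteq> 0"
  proof
    assume "U = 0"
    then obtain k t where k: "u1 = k *s ray t" unfolding U_def by (rule null_is_scaled_ray)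
    have "k \<noteq> 0" using k yu by (auto simp: mink_linear)
    then have "t = \<delta> None" using uP(1) k unfolding P_def by (simp add: mink_linear mink_ray_ray)
    then show False using k yu(2) y1(1) unfolding P_def by (simp add: mink_linear)
  qed
  have norm: "msq (f' (a, b)) = U * g (a * a + b * b)" for a b
    unfolding f'g by (simp add: mink_linear u12 u21 U2 U_def[symmetric] g(2,3) algebra_simps)

  define h :: 'a where "h = 1 / 2"
  have h: "2 * h = 1" "h * 2 = 1" unfolding h_def using two_ne_0 by simp_all
  define k where "k = U / 4"
  have Uk: "U = 4 * k" unfolding k_def using four_ne_0 by simp
  have k: "k \<noteq> 0" using \<open>U \<noteq> 0\<close> Uk by auto
  \<comment> \<open>Sends \<open>ray (Some (0, 0))\<close> to \<open>E\<close>,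
    \<open>ray None\<close> to -k P, and twice the first two basis vectors to \<open>u1\<close> and
    \<open>u2\<close>. The value k = U/4 matches the coefficient of \<open>P\<close> in
    \<open>R\<close>.\<close>
  define M :: "'a ^ 4 ^ 4" where "M = (\<chi> i j. if j = 1 then h * u1 $ i else if j = 2 then h * u2 $ i
     else if j = 3 then h * (- k * P $ i - E $ i) else h * (- k * P $ i + E $ i))"
  have M: "M *v v = (h * v$1) *s u1 + (h * v$2) *s u2 + (- k * (h * (v$3 + v$4))) *s P
      + (h * (v$4 - v$3)) *s E" for v
    unfolding M_def matrix_vector_mult_def vec_eq_iff by (simp add: sum_4 algebra_simps)
  show ?thesis
  proof (rule that[of g "- k" M])
    show "field_automorphism g" by (rule aut)
    show "- k \<noteq> 0" using k by simp
    show "mink (M *v v) (M *v w) = - k * mink v w" for v w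
    proof -
      have "mink (M *v v) (M *v w) = h * v$1 * (h * w$1 * U) + h * v$2 * (h * w$2 * U)
        + (- k * (h * (v$3 + v$4))) * (h * (w$4 - w$3) * 2)
        + (h * (v$4 - v$3)) * (- k * (h * (w$3 + w$4)) * 2)"
        unfolding M by (simp add: mink_linear u12 u21 U2 U_def[symmetric] uP EP P0 algebra_simps)
      also have "\<dots> = (2 * h) * (2 * h) * (- k * mink v w)"
        unfolding mink_def Uk by (simp add: algebra_simps)
      finally show ?thesis unfolding h by simp
    qed
    show "\<exists>k. k \<noteq> 0 \<and> M *v vmap g (ray t) = k *s ray (\<delta> t)" for t
    proof (cases t)
      case None
      have "M *v vmap g (ray t) = (- k) *s ray (\<delta> t)"
        unfolding M None vmap_def by (simp add: ray_nth g0 g(4) P_def h)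
      then show ?thesis using k by (metis neg_equal_0_iff_equal)
    next
      case (Some w)
      obtain a b where w: "w = (a, b)" by fastforce
      have "g (a * a + b * b - 1) + g (a * a + b * b + 1) = 2 * g (a * a + b * b)"
        "g (a * a + b * b + 1) - g (a * a + b * b - 1) = 2"
        unfolding gd g(2)[of _ 1] g(4) by simp_all
      then have e: "h * (g (a * a + b * b - 1) + g (a * a + b * b + 1)) = g (a * a + b * b)"
        "h * (g (a * a + b * b + 1) - g (a * a + b * b - 1)) = 1"
        "h * g (2 * a) = g a" "h * g (2 * b) = g b"
        by (simp_all add: h g(3) g2 mult.assoc[symmetric])
      have n: "msq (f' (a, b)) / 4 = k * g (a * a + b * b)" unfolding norm k_def by simp
      have "M *v vmap g (ray t) = g a *s u1 + g b *s u2 + (- k * g (a * a + b * b)) *s P + 1 *s E"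
        unfolding M Some w vmap_def vec_lambda_beta ray_nth e ..
      also have "\<dots> = R w"
        unfolding R[of w] unfolding w n unfolding f'g by simp
      finally show ?thesis unfolding R_def Some using c by blast
    qed
  qed
qed

end

section \<open>Classification\<close>

lemma field_automorphism_simps:
  assumes "field_automorphism g"
  shows "g (x + y) = g x + g y" "g (x * y) = g x * g y" "g 1 = 1" "g 0 = 0" "g (- x) = - g x"
    "g (x - y) = g x - g y" "g x = 0 \<longleftrightarrow> x = 0"
proof -
  show add: "g (x + y) = g x + g y" and "g (x * y) = g x * g y" "g 1 = 1" for x y
    using assms unfolding field_automorphism_def by auto
  show 0: "g 0 = 0" using add[of 0 0] by (metis add_0 add_cancel_right_right)
  show m: "g (- x) = - g x" for x using add[of x "- x"] 0 by (simp add: eq_neg_iff_add_eq_0 add.commute)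
  show "g (x - y) = g x - g y" using add[of x "- y"] m by simp
  have "inj g" using assms unfolding field_automorphism_def by (simp add: bij_def)
  then show "g x = 0 \<longleftrightarrow> x = 0" using 0 by (metis injD)
qed

lemma vmap_simps:
  assumes "field_automorphism g"
  shows "vmap g (x + y) = vmap g x + vmap g y" "vmap g (x - y) = vmap g x - vmap g y"
    "vmap g (k *s x) = g k *s vmap g x" "mink (vmap g x) (vmap g y) = g (mink x y)"
    "vmap g x = vmap g y \<longleftrightarrow> x = y"
proof -
  have "inj g" using assms unfolding field_automorphism_def by (simp add: bij_def)
  then show "vmap g x = vmap g y \<longleftrightarrow> x = y" by (simp add: vmap_def vec_eq_iff inj_eq)
qed (simp_all add: vmap_def vec_eq_iff mink_def field_automorphism_simps[OF assms])

context minkowski_field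
begin

lemma obtain_msq:
  obtains x where "msq x = c"
proof -
  have "4 * msq (vec4 0 0 ((c - 1) / 2) ((c + 1) / 2)) = 4 * c"
    unfolding mink_def using two_ne_0 four_ne_0 by (simp add: divide_simps) (simp add: algebra_simps)
  then have "msq (vec4 0 0 ((c - 1) / 2) ((c + 1) / 2)) = c"
    using four_ne_0 by (simp only: mult_cancel_left) simp
  then show ?thesis using that by blast
qed

text \<open>The factor is plus or minus a square; dividing by the root leaves factor 1 or
  -1.\<close>

lemma similitude_normalize:
  fixes s :: 'a and M :: "'a ^ 4 ^ 4"
  assumes "s \<noteq> 0" "\<And>v w. mink (M *v v) (M *v w) = s * mink v w"
  obtains n N where "n \<noteq> 0" "lorentz N \<or> anti_lorentz N" "\<And>v. M *v v = n *s (N *v v)"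
proof -
  obtain n where n: "s = n * n \<or> s = - (n * n)" using plus_minus_square by blast
  then have "n \<noteq> 0" using assms(1) by auto
  define N where "N = (\<chi> i j. M $ i $ j / n)"
  have NM: "N *v v = (1 / n) *s (M *v v)" for v
    unfolding N_def matrix_vector_mult_def by (simp add: vec_eq_iff sum_divide_distrib)
  have N: "mink (N *v v) (N *v w) = s / (n * n) * mink v w" for v w
    unfolding NM by (simp add: mink_linear assms(2))
  have "lorentz N \<or> anti_lorentz N"
    unfolding lorentz_def anti_lorentz_def N using n \<open>n \<noteq> 0\<close> by auto
  moreover have "M *v v = n *s (N *v v)" for v unfolding NM using \<open>n \<noteq> 0\<close> by simp
  ultimately show ?thesis using that \<open>n \<noteq> 0\<close> by blast
qed

end

context light_speed_map
begin

lemma radial_factor: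
  obtains g M s m where "field_automorphism g" "s \<noteq> 0"
    "\<And>v w. mink (M *v v) (M *v w) = s * mink v w"
    "\<And>x. msq x \<noteq> 0 \<Longrightarrow> \<phi> x = m (msq x) *s (M *v vmap g x)"
    "\<And>c d. c \<noteq> 0 \<Longrightarrow> d \<noteq> 0 \<Longrightarrow> m c = m d \<or> m c * g c = m d * g d"
proof -
  obtain g M s where g: "field_automorphism g" and s: "s \<noteq> 0"
    and M: "\<And>v w. mink (M *v v) (M *v w) = s * mink v w"
    and ray: "\<And>t. \<exists>k. k \<noteq> 0 \<and> M *v vmap g (ray t) = k *s ray (\<delta> t)"
    by (rule semilinear_model) blast
  define T where "T x = M *v vmap g x" for x
  have mT: "mink (T x) (T y) = s * g (mink x y)" for x y
    unfolding T_def M vmap_simps(4)[OF g] ..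
  have T_add: "T (x + k *s y) = T x + g k *s T y" for x y k
    unfolding T_def by (simp add: vmap_simps[OF g] matrix_vector_right_distrib vec.scale)
  have "surj \<delta>" using delta_inj by (auto intro!: finite_UNIV_inj_surj injI)
  \<comment> \<open>\<open>T x\<close> and \<open>\<phi> x\<close> have the same circle of
    orthogonal directions, which determines a vector up to a scalar.\<close>
  have ex: "\<exists>k. \<phi> x = k *s T x" if x: "msq x \<noteq> 0" for x
  proof (rule perp_subset_imp_parallel)
    show "msq (T x) \<noteq> 0" using x s by (simp add: mT field_automorphism_simps[OF g])
    show "perp (T x) \<subseteq> perp (\<phi> x)"
    proof
      fix w assume w: "w \<in> perp (T x)"
      obtain t where t: "w = \<delta> t" using \<open>surj \<delta>\<close> by blast
      obtain k where k: "T (ray t) = k *s ray (\<delta> t)" using ray[of t] unfolding T_def by blast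
      have "mink (T x) (T (ray t)) = 0" using w unfolding k t perp_def by (simp add: mink_linear)
      then have "t \<in> perp x" using s by (simp add: mT perp_def field_automorphism_simps[OF g])
      then show "w \<in> perp (\<phi> x)" using delta_perp_iff[OF x] t by simp
    qed
  qed
  then obtain \<mu> where \<mu>: "\<And>x. msq x \<noteq> 0 \<Longrightarrow> \<phi> x = \<mu> x *s T x" by metis
  \<comment> \<open>The difference of the images is a multiple of the nonnull \<open>T x\<close>
    plus a null vector orthogonal to it; being null, it has zero coefficient at
    \<open>T x\<close>.\<close>
  have \<mu>_shift: "\<mu> (x + k *s ray u) = \<mu> x" if x: "msq x \<noteq> 0" and u: "u \<in> perp x" for x u k
  proof -
    let ?y = "x + k *s ray u"
    have y: "msq ?y \<noteq> 0" using msq_shift_perp[OF u] x by simp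
    obtain l where "\<phi> ?y = \<phi> x + l *s ray (dir x u)" using dir[OF x y] by metis
    then have "msq (\<phi> ?y - \<phi> x) = 0" by (simp add: mink_linear)
    moreover have "\<phi> ?y - \<phi> x = (\<mu> ?y - \<mu> x) *s T x + (\<mu> ?y * g k) *s T (ray u)"
      unfolding \<mu>[OF x] \<mu>[OF y] T_add by (simp add: vec_eq_iff algebra_simps)
    moreover have "mink (T x) (T (ray u)) = 0" "mink (T (ray u)) (T x) = 0"
      "mink (T (ray u)) (T (ray u)) = 0" "msq (T x) \<noteq> 0"
      using u x s mink_commute[of x "ray u"] unfolding mT perp_def
      by (simp_all add: field_automorphism_simps[OF g])
    ultimately show ?thesis by (simp add: mink_linear)
  qed
  have \<mu>_sphere: "\<mu> z = \<mu> x" if x: "msq x \<noteq> 0" and z: "msq z = msq x" for x z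
    by (rule sphere_induct[where P = "\<lambda>z. \<mu> z = \<mu> x", OF x refl z]) (use \<mu>_shift x in auto)
  define m where "m c = \<mu> (SOME x. msq x = c)" for c
  have m: "\<mu> x = m (msq x)" if "msq x \<noteq> 0" for x
  proof -
    have "msq (SOME z. msq z = msq x) = msq x" by (rule someI) simp
    from \<mu>_sphere[OF that this, symmetric] show ?thesis unfolding m_def .
  qed
  \<comment> \<open>A null line joins the spheres of c and d. Nullity of the image difference
    factors as (m c - m d)(m c g c - m d g d) = 0.\<close>
  have pair: "m c = m d \<or> m c * g c = m d * g d" if c: "c \<noteq> 0" and d: "d \<noteq> 0" and ne: "c \<noteq> d" for c d
  proof -
    obtain x where x: "msq x = c" using obtain_msq .
    obtain u where u: "u \<notin> perp x" using obtain_not_perp[of x] x c by auto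
    then have nz: "2 * mink x (ray u) \<noteq> 0" using two_ne_0 by (simp add: perp_def)
    define k where "k = (d - c) / (2 * mink x (ray u))"
    define y where "y = x + k *s ray u"
    have "k * (2 * mink x (ray u)) = d - c" unfolding k_def using nz by (metis nonzero_divide_eq_eq)
    then have y: "msq y = d" unfolding y_def msq_shift x by (simp add: mult.assoc mult.left_commute)
    have xy: "msq (x - y) = 0" unfolding y_def by (simp add: mink_linear)
    then have "c + d = 2 * mink x y" by (simp add: msq_diff x y)
    then have "g (c + d) = g (2 * mink x y)" by simp
    then have gg: "g c + g d = 2 * g (mink x y)"
      by (metis field_automorphism_simps(1)[OF g] mult_2)
    have px: "\<phi> x = m c *s T x" and py: "\<phi> y = m d *s T y"
      using \<mu> m x y c d by metis+
    have "msq (\<phi> x - \<phi> y) = 0" using adjacent[of x y] xy x y c d ne by auto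
    then have "m c * (m c * (s * g c)) + m d * (m d * (s * g d)) - 2 * (m c * (m d * (s * g (mink x y)))) = 0"
      unfolding msq_diff px py by (simp add: mink_linear mT x y)
    moreover have "m c * (m c * (s * g c)) + m d * (m d * (s * g d)) - 2 * (m c * (m d * (s * g (mink x y))))
        = m c * (m c * (s * g c)) + m d * (m d * (s * g d)) - m c * (m d * (s * (2 * g (mink x y))))"
      by simp
    ultimately have "m c * (m c * (s * g c)) + m d * (m d * (s * g d)) - m c * (m d * (s * (g c + g d))) = 0"
      unfolding gg by simp
    then have "s * ((m c - m d) * (m c * g c - m d * g d)) = 0" by (simp add: algebra_simps)
    then show ?thesis using s by auto
  qed
  show ?thesis
  proof (rule that[OF g s M])
    show "\<phi> x = m (msq x) *s (M *v vmap g x)" if "msq x \<noteq> 0" for x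
      using \<mu>[OF that] m[OF that] unfolding T_def by simp
    show "m c = m d \<or> m c * g c = m d * g d" if "c \<noteq> 0" "d \<noteq> 0" for c d
      using pair[OF that] by blast
  qed
qed

lemma classification:
  "\<exists>\<alpha> \<tau> M. \<alpha> \<noteq> 0 \<and> field_automorphism \<tau> \<and> (lorentz M \<or> anti_lorentz M) \<and>
     ((\<forall>r\<in>- light_cone. \<phi> r = \<alpha> *s (M *v vmap \<tau> r)) \<or>
      (\<forall>r\<in>- light_cone. \<phi> r = (\<alpha> / mink (vmap \<tau> r) (vmap \<tau> r)) *s (M *v vmap \<tau> r)))"
proof -
  obtain g M s m where g: "field_automorphism g" and s: "s \<noteq> 0"
    and M: "\<And>v w. mink (M *v v) (M *v w) = s * mink v w"
    and \<phi>: "\<And>x. msq x \<noteq> 0 \<Longrightarrow> \<phi> x = m (msq x) *s (M *v vmap g x)"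
    and pair: "\<And>c d. c \<noteq> 0 \<Longrightarrow> d \<noteq> 0 \<Longrightarrow> m c = m d \<or> m c * g c = m d * g d"
    by (rule radial_factor) blast
  obtain n N where N: "n \<noteq> 0" "lorentz N \<or> anti_lorentz N" "\<And>v. M *v v = n *s (N *v v)"
    by (rule similitude_normalize[OF s M]) blast
  note gs = field_automorphism_simps[OF g]
  have m1: "m 1 \<noteq> 0"
  proof
    assume 0: "m 1 = 0"
    obtain x where x: "msq x = 1" using obtain_msq .
    then have "\<phi> x = 0" using \<phi>[of x] 0 by simp
    then show False using nonnull[of x] x by (simp add: mink_linear)
  qed
  \<comment> \<open>The alternative holds pairwise; comparing with 1 makes it uniform, because two
    values violating different branches would contradict \<open>pair\<close> for each other.\<close>
  have "(\<forall>c. c \<noteq> 0 \<longrightarrow> m c = m 1) \<or> (\<forall>c. c \<noteq> 0 \<longrightarrow> m c * g c = m 1)"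
  proof (rule ccontr)
    assume "\<not> ?thesis"
    then obtain c d where c: "c \<noteq> 0" "m c \<noteq> m 1" and d: "d \<noteq> 0" "m d * g d \<noteq> m 1" by blast
    then have "m c * g c = m 1" "m d = m 1" using pair[of c 1] pair[of d 1] gs(3) by auto
    then show False using pair[of c d] c d by auto
  qed
  then have "(\<forall>r\<in>- light_cone. \<phi> r = (m 1 * n) *s (N *v vmap g r)) \<or>
      (\<forall>r\<in>- light_cone. \<phi> r = ((m 1 * n) / mink (vmap g r) (vmap g r)) *s (N *v vmap g r))"
  proof
    assume m: "\<forall>c. c \<noteq> 0 \<longrightarrow> m c = m 1"
    have "\<phi> r = (m 1 * n) *s (N *v vmap g r)" if "r \<in> - light_cone" for r
    proof -
      have r0: "msq r \<noteq> 0" using that unfolding light_cone_def by simp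
      then have "m (msq r) = m 1" using m by blast
      then show ?thesis unfolding \<phi>[OF r0] N(3) by simp
    qed
    then show ?thesis by blast
  next
    assume m: "\<forall>c. c \<noteq> 0 \<longrightarrow> m c * g c = m 1"
    have "\<phi> r = ((m 1 * n) / mink (vmap g r) (vmap g r)) *s (N *v vmap g r)"
      if "r \<in> - light_cone" for r
    proof -
      have r0: "msq r \<noteq> 0" using that unfolding light_cone_def by simp
      then have "m (msq r) = m 1 / g (msq r)" using m gs(7) by (metis nonzero_eq_divide_eq)
      then show ?thesis unfolding \<phi>[OF r0] N(3) vmap_simps(4)[OF g] by simp
    qed
    then show ?thesis by blast
  qed
  moreover have "m 1 * n \<noteq> 0" using m1 N(1) by simp
  ultimately show ?thesis using g N(2) by blast
qed

end

section \<open>The converse\<close>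

lemma similitude_image_eq:
  fixes M :: "'a::field ^ 4 ^ 4"
  assumes "lorentz M \<or> anti_lorentz M" "M *v v = M *v w"
  shows "v = w"
proof -
  have "mink (v - w) z = 0" for z
  proof -
    have "M *v (v - w) = 0" using assms(2) by (simp add: matrix_vector_mult_diff_distrib)
    then have "mink (M *v (v - w)) (M *v z) = 0" by (simp add: mink_linear)
    then show ?thesis using assms(1) unfolding lorentz_def anti_lorentz_def by auto
  qed
  then show ?thesis using mink_nondegenerate[of "v - w"] by simp
qed

lemma similitude_null:
  assumes "lorentz M \<or> anti_lorentz M" "mink v v = 0"
  shows "mink (M *v v) (M *v v) = 0"
  using assms unfolding lorentz_def anti_lorentz_def by auto

lemma linear_form_adjacent:
  assumes \<alpha>: "\<alpha> \<noteq> (0 :: 'a::field)" and \<tau>: "field_automorphism \<tau>" and M: "lorentz M \<or> anti_lorentz M"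
    and adj: "mink (r1 - r2) (r1 - r2) = 0" "r1 \<noteq> r2"
  defines "\<psi> \<equiv> \<lambda>r. \<alpha> *s (M *v vmap \<tau> r)"
  shows "mink (\<psi> r1 - \<psi> r2) (\<psi> r1 - \<psi> r2) = 0 \<and> \<psi> r1 \<noteq> \<psi> r2"
proof
  have "\<psi> r1 - \<psi> r2 = \<alpha> *s (M *v vmap \<tau> (r1 - r2))"
    unfolding \<psi>_def by (simp add: vmap_simps[OF \<tau>] matrix_vector_mult_diff_distrib vector_ssub_ldistrib)
  moreover have "mink (vmap \<tau> (r1 - r2)) (vmap \<tau> (r1 - r2)) = 0"
    unfolding vmap_simps(4)[OF \<tau>] adj by (simp add: field_automorphism_simps[OF \<tau>])
  ultimately show "mink (\<psi> r1 - \<psi> r2) (\<psi> r1 - \<psi> r2) = 0"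
    using similitude_null[OF M] by (simp add: mink_linear)
  show "\<psi> r1 \<noteq> \<psi> r2"
  proof
    assume "\<psi> r1 = \<psi> r2"
    then have "M *v vmap \<tau> r1 = M *v vmap \<tau> r2" unfolding \<psi>_def using \<alpha> by simp
    then show False using similitude_image_eq[OF M] vmap_simps(5)[OF \<tau>] adj(2) by blast
  qed
qed

text \<open>The inversion \<open>r \<mapsto> r / (r, r)\<close> preserves adjacency because
  \<open>(r1/n1 - r2/n2, r1/n1 - r2/n2) = (r1 - r2, r1 - r2) / (n1 n2)\<close> for \<open>n\<^sub>i = (r\<^sub>i, r\<^sub>i)\<close>.\<close>

lemma inversion_adjacent:
  fixes r1 r2 :: "'a::field ^ 4"
  assumes nn: "mink r1 r1 \<noteq> 0" "mink r2 r2 \<noteq> 0" and adj: "mink (r1 - r2) (r1 - r2) = 0" "r1 \<noteq> r2"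
  defines "\<iota> \<equiv> \<lambda>r :: 'a ^ 4. (1 / mink r r) *s r"
  shows "mink (\<iota> r1 - \<iota> r2) (\<iota> r1 - \<iota> r2) = 0 \<and> \<iota> r1 \<noteq> \<iota> r2"
proof
  have sym: "mink r2 r1 = mink r1 r2" by (rule mink_commute)
  have "mink (\<iota> r1 - \<iota> r2) (\<iota> r1 - \<iota> r2) * (mink r1 r1 * mink r2 r2) = mink (r1 - r2) (r1 - r2)"
    unfolding \<iota>_def using nn by (simp add: mink_linear sym divide_simps)
  then show "mink (\<iota> r1 - \<iota> r2) (\<iota> r1 - \<iota> r2) = 0" using adj nn by simp
  show "\<iota> r1 \<noteq> \<iota> r2"
  proof
    assume eq: "\<iota> r1 = \<iota> r2"
    have "mink (\<iota> r) (\<iota> r) = 1 / mink r r" if "mink r r \<noteq> 0" for r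
      unfolding \<iota>_def using that by (simp add: mink_linear)
    then have "1 / mink r1 r1 = 1 / mink r2 r2" using eq nn by metis
    then have "r1 = r2" using eq nn(1) unfolding \<iota>_def by simp
    then show False using adj(2) by simp
  qed
qed

theorem theorem4p10:
  fixes \<phi> :: "'a::{field,finite} ^ 4 \<Rightarrow> 'a ^ 4"
  assumes q_mod: "CARD('a) mod 4 = 3"
    and q_ne3: "CARD('a) \<noteq> 3"
    and maps: "\<phi> ` (- light_cone) \<subseteq> - light_cone"
  shows "(\<forall>r1\<in>- light_cone. \<forall>r2\<in>- light_cone.
            mink (r1 - r2) (r1 - r2) = 0 \<and> r1 \<noteq> r2 \<longrightarrow>
            mink (\<phi> r1 - \<phi> r2) (\<phi> r1 - \<phi> r2) = 0 \<and> \<phi> r1 \<noteq> \<phi> r2)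
    \<longleftrightarrow>
    (\<exists>\<alpha> \<tau> M. \<alpha> \<noteq> 0 \<and> field_automorphism \<tau> \<and> (lorentz M \<or> anti_lorentz M) \<and>
       ((\<forall>r\<in>- light_cone. \<phi> r = \<alpha> *s (M *v vmap \<tau> r)) \<or>
        (\<forall>r\<in>- light_cone. \<phi> r =
            (\<alpha> / mink (vmap \<tau> r) (vmap \<tau> r)) *s (M *v vmap \<tau> r))))"
    (is "?L \<longleftrightarrow> ?R")
proof
  assume L: ?L
  interpret light_speed_map \<phi>
  proof unfold_locales
    show "mink (\<phi> x) (\<phi> x) \<noteq> 0" if "mink x x \<noteq> 0" for x
      using maps that unfolding light_cone_def by auto
    show "mink (\<phi> x - \<phi> y) (\<phi> x - \<phi> y) = 0 \<and> \<phi> x \<noteq> \<phi> y"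
      if "mink x x \<noteq> 0" "mink y y \<noteq> 0" "x \<noteq> y" "mink (x - y) (x - y) = 0" for x y
      using L that unfolding light_cone_def by blast
  qed (use q_mod q_ne3 in auto)
  show ?R by (rule classification)
next
  assume ?R
  then obtain \<alpha> \<tau> M where \<alpha>: "\<alpha> \<noteq> 0" and \<tau>: "field_automorphism \<tau>" and M: "lorentz M \<or> anti_lorentz M"
    and forms: "(\<forall>r\<in>- light_cone. \<phi> r = \<alpha> *s (M *v vmap \<tau> r)) \<or>
        (\<forall>r\<in>- light_cone. \<phi> r = (\<alpha> / mink (vmap \<tau> r) (vmap \<tau> r)) *s (M *v vmap \<tau> r))"
    by blast
  \<comment> \<open>The second form is the first one applied after the inversion r -> r/(r, r),
    since \<open>\<tau>\<close> commutes with taking inverses and with the form.\<close>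
  have inv: "(\<alpha> / mink (vmap \<tau> r) (vmap \<tau> r)) *s (M *v vmap \<tau> r)
      = \<alpha> *s (M *v vmap \<tau> ((1 / mink r r) *s r))" if "mink r r \<noteq> 0" for r
  proof -
    have "\<tau> (1 / mink r r) * \<tau> (mink r r) = 1"
      using that field_automorphism_simps(2,3)[OF \<tau>] by (metis nonzero_eq_divide_eq)
    then have "\<tau> (1 / mink r r) = 1 / mink (vmap \<tau> r) (vmap \<tau> r)"
      using that field_automorphism_simps(7)[OF \<tau>]
      unfolding vmap_simps(4)[OF \<tau>] by (metis nonzero_eq_divide_eq)
    then show ?thesis by (simp add: vmap_simps(3)[OF \<tau>] vec.scale)
  qed
  show ?L
  proof (intro ballI impI)
    fix r1 r2 :: "'a ^ 4"
    assume "r1 \<in> - light_cone" "r2 \<in> - light_cone"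
      and adj: "mink (r1 - r2) (r1 - r2) = 0 \<and> r1 \<noteq> r2"
    then have r: "r1 \<in> - light_cone" "mink r1 r1 \<noteq> 0" "r2 \<in> - light_cone" "mink r2 r2 \<noteq> 0"
      unfolding light_cone_def by auto
    from forms show "mink (\<phi> r1 - \<phi> r2) (\<phi> r1 - \<phi> r2) = 0 \<and> \<phi> r1 \<noteq> \<phi> r2"
    proof
      assume "\<forall>r\<in>- light_cone. \<phi> r = \<alpha> *s (M *v vmap \<tau> r)"
      then have "\<phi> r1 = \<alpha> *s (M *v vmap \<tau> r1)" "\<phi> r2 = \<alpha> *s (M *v vmap \<tau> r2)"
        using r by blast+
      then show ?thesis using linear_form_adjacent[OF \<alpha> \<tau> M] adj by metis
    next
      assume "\<forall>r\<in>- light_cone. \<phi> r = (\<alpha> / mink (vmap \<tau> r) (vmap \<tau> r)) *s (M *v vmap \<tau> r)"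
      then have "\<phi> r1 = \<alpha> *s (M *v vmap \<tau> ((1 / mink r1 r1) *s r1))"
        "\<phi> r2 = \<alpha> *s (M *v vmap \<tau> ((1 / mink r2 r2) *s r2))"
        using r inv by metis+
      then show ?thesis
        using linear_form_adjacent[OF \<alpha> \<tau> M] inversion_adjacent[OF r(2,4)] adj by metis
    qed
  qed
qed

end
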